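(* Let $f:\mathbb{R}^M\to\mathbb{R}^N$ be a $C^\infty$ function and let $\mu$ be any probability measure on $\mathbb{R}^M$ that is absolutely continuous with respect to Lebesgue measure. Then, for $\mu$-almost every $x\in\mathbb{R}^M$, the pointwise dimension $d^f_\mu(x)$ exists (i.e. $\underline{d}^f_\mu(x)=\overline{d}^f_\mu(x)$) and belongs to $\{0,1,\dots,\min\{M,N\}\}$. More precisely, $d^f_\mu(x)=\operatorname{rank} d_xf$ for $\mu$-almost every $x\in\mathbb{R}^M$, where $d_xf$ is the differential of $f$ at $x$.
   Context: The lower and upper pointwise dimensions of a Borel probability measure $\nu$ on $\mathbb{R}^N$ at $y$ are \[\underline{d}_\nu(y)=\liminf_{r\to0}\frac{\log\nu(B(y,r))}{\log r},\qquad \overline{d}_\nu(y)=\limsup_{r\to0}\frac{\log\nu(B(y,r))}{\log r},\] where $B(y,r)$ is the open Euclidean ball with center $y$ and radius $r$. With the pushforward $f_*\mu(\cdot):=\mu(f^{-1}(\cdot))$, set $\underline{d}^f_\mu(x)=\underline{d}_{f_*\mu}(f(x))$ and $\overline{d}^f_\mu(x)=\overline{d}_{f_*\mu}(f(x))$; when they are equal, $d^f_\mu(x)$ denotes the common value. *)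

theory Defs
  imports "HOL-Analysis.Analysis" "HOL-Probability.Probability"
begin

(* In finite dimension, quantifying over all directions v agrees with quantifying over
   the coordinate directions, i.e. with continuity of all partial derivatives up to order k. *)
primrec C_k :: "nat \<Rightarrow> ('a::euclidean_space \<Rightarrow> 'b::euclidean_space) \<Rightarrow> bool" where
  "C_k 0 f \<longleftrightarrow> continuous_on UNIV f"
| "C_k (Suc k) f \<longleftrightarrow>
     (\<forall>x. f differentiable (at x)) \<and> (\<forall>v. C_k k (\<lambda>x. frechet_derivative f (at x) v))"

definition C_infinity :: "('a::euclidean_space \<Rightarrow> 'b::euclidean_space) \<Rightarrow> bool" where
  "C_infinity f \<longleftrightarrow> (\<forall>k. C_k k f)"

(* The library has ln 0 = 0, whereas log 0 must be minus infinity here: the pointwise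
   dimension at a point outside the support is plus infinity. *)
definition ext_ln :: "real \<Rightarrow> ereal" where
  "ext_ln p = (if p = 0 then -\<infinity> else ereal (ln p))"

definition lower_pointwise_dim :: "'a::metric_space measure \<Rightarrow> 'a \<Rightarrow> ereal" where
  "lower_pointwise_dim \<nu> y =
     Liminf (at_right 0) (\<lambda>r. ext_ln (measure \<nu> (ball y r)) / ereal (ln r))"

definition upper_pointwise_dim :: "'a::metric_space measure \<Rightarrow> 'a \<Rightarrow> ereal" where
  "upper_pointwise_dim \<nu> y =
     Limsup (at_right 0) (\<lambda>r. ext_ln (measure \<nu> (ball y r)) / ereal (ln r))"

definition lower_pointwise_dim_along ::
    "('a \<Rightarrow> 'b::metric_space) \<Rightarrow> 'a measure \<Rightarrow> 'a \<Rightarrow> ereal" where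
  "lower_pointwise_dim_along f \<mu> x = lower_pointwise_dim (distr \<mu> borel f) (f x)"

definition upper_pointwise_dim_along ::
    "('a \<Rightarrow> 'b::metric_space) \<Rightarrow> 'a measure \<Rightarrow> 'a \<Rightarrow> ereal" where
  "upper_pointwise_dim_along f \<mu> x = upper_pointwise_dim (distr \<mu> borel f) (f x)"

definition has_pointwise_dim_along ::
    "('a \<Rightarrow> 'b::metric_space) \<Rightarrow> 'a measure \<Rightarrow> 'a \<Rightarrow> ereal \<Rightarrow> bool" where
  "has_pointwise_dim_along f \<mu> x d \<longleftrightarrow>
     lower_pointwise_dim_along f \<mu> x = d \<and> upper_pointwise_dim_along f \<mu> x = d"

definition differential_rank ::
    "('a::euclidean_space \<Rightarrow> 'b::euclidean_space) \<Rightarrow> 'a \<Rightarrow> nat" where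
  "differential_rank f x = dim (range (frechet_derivative f (at x)))"

end

theory Submission
  imports Defs
begin

text \<open>
  Write \<open>k\<close> for the rank of the differential at a point and \<open>\<nu>\<close> for the image of \<open>\<mu>\<close> under \<open>f\<close>.
  Near \<open>x0\<close> there are linear maps \<open>L\<close> and \<open>P\<close>, \<open>P\<close> a projection onto the kernel of the
  differential at \<open>x0\<close> (of codimension \<open>k\<close>), such that \<open>G = L \<circ> f + P\<close> is a bi-Lipschitz chart.

  Lower bound for the dimension: in this chart the Lebesgue measure of a preimage of a ball of radius
  \<open>r\<close> is \<open>O(r ^ k)\<close>, and any two finite measures satisfy
  \<open>\<nu>2 (ball y r) \<le> r powr (- \<delta>) * \<nu>1 (ball y r)\<close> along \<open>r = 2 ^ - n\<close> for \<open>\<nu>1\<close>-almost every \<open>y\<close>.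
  Taking for \<open>\<nu>1\<close> the image of Lebesgue measure on the chart domain and \<open>\<nu>2 = \<nu>\<close>, neither the
  density of \<open>\<mu>\<close> nor the points of different rank matter.

  Upper bound, in the spirit of the Morse--Sard theorem: the derivative of \<open>f\<close> along the directions
  in which \<open>L \<circ> f\<close> is constant is controlled by smooth functions that vanish where the rank is \<open>k\<close>,
  and hence vanish to any order \<open>m\<close> at almost every point of that set.  So up to null sets the set
  of points of rank \<open>k\<close> is a countable union of sets whose images are covered by
  \<open>O(r powr - (k + M / m))\<close> balls of radius \<open>r\<close>, \<open>M\<close> being the dimension of the domain, and the
  Borel--Cantelli lemma bounds \<open>\<nu>\<close> from below.
\<close>

subsection \<open>Calculus of smooth functions\<close>

lemma C_k_SucI:
  assumes "\<And>x. (f has_derivative f' x) (at x)" and "\<And>v. C_k k (\<lambda>x. f' x v)"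
  shows "C_k (Suc k) f"
proof -
  have "frechet_derivative f (at x) = f' x" for x
    using frechet_derivative_at[OF assms(1)] by simp
  then show ?thesis
    using assms by (auto simp: differentiable_def)
qed

lemma C_k_Suc_imp_C_k: "C_k (Suc k) f \<Longrightarrow> C_k k f"
proof (induction k arbitrary: f)
  case 0
  then show ?case
    by (auto intro!: differentiable_imp_continuous_on simp: differentiable_on_def
        intro: differentiable_at_withinI)
next
  case (Suc k)
  then show ?case
    by (metis C_k.simps(2))
qed

lemma C_k_const: "C_k k (\<lambda>x. c)"
proof (induction k arbitrary: c)
  case (Suc k)
  show ?case
    by (rule C_k_SucI[where f' = "\<lambda>x v. 0"]) (auto simp: Suc)
qed auto

lemma C_k_Suc_has_derivative:
  "C_k (Suc k) f \<Longrightarrow> (f has_derivative frechet_derivative f (at x)) (at x)"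
  by (simp add: frechet_derivative_works)

lemma C_k_add:
  "C_k k f \<Longrightarrow> C_k k g \<Longrightarrow> C_k k (\<lambda>x. f x + g x)"
proof (induction k arbitrary: f g)
  case 0
  then show ?case by (auto intro: continuous_on_add)
next
  case (Suc k)
  show ?case
  proof (rule C_k_SucI)
    show "((\<lambda>x. f x + g x) has_derivative
        (\<lambda>v. frechet_derivative f (at x) v + frechet_derivative g (at x) v)) (at x)" for x
      using Suc.prems by (intro has_derivative_add C_k_Suc_has_derivative)
    show "C_k k (\<lambda>x. frechet_derivative f (at x) v + frechet_derivative g (at x) v)" for v
      using Suc.prems by (intro Suc.IH) simp_all
  qed
qed

lemma C_k_bounded_linear:
  assumes "bounded_linear h"
  shows "C_k k f \<Longrightarrow> C_k k (\<lambda>x. h (f x))"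
proof (induction k arbitrary: f)
  case 0
  then show ?case
    using bounded_linear.continuous_on[OF assms] by simp
next
  case (Suc k)
  show ?case
  proof (rule C_k_SucI)
    show "((\<lambda>x. h (f x)) has_derivative (\<lambda>v. h (frechet_derivative f (at x) v))) (at x)" for x
      using Suc.prems by (intro bounded_linear.has_derivative[OF assms] C_k_Suc_has_derivative)
    show "C_k k (\<lambda>x. h (frechet_derivative f (at x) v))" for v
      using Suc.prems by (intro Suc.IH) simp_all
  qed
qed

lemma C_k_bounded_bilinear:
  assumes "bounded_bilinear h"
  shows "C_k k f \<Longrightarrow> C_k k g \<Longrightarrow> C_k k (\<lambda>x. h (f x) (g x))"
proof (induction k arbitrary: f g)
  case 0
  then show ?case
    using bounded_bilinear.continuous_on[OF assms] by simp
next
  case (Suc k)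
  have "C_k k f" "C_k k g"
    using Suc.prems C_k_Suc_imp_C_k by blast+
  show ?case
  proof (rule C_k_SucI)
    show "((\<lambda>x. h (f x) (g x)) has_derivative
        (\<lambda>v. h (f x) (frechet_derivative g (at x) v) + h (frechet_derivative f (at x) v) (g x))) (at x)"
      for x
      using Suc.prems by (intro bounded_bilinear.FDERIV[OF assms] C_k_Suc_has_derivative)
    show "C_k k (\<lambda>x. h (f x) (frechet_derivative g (at x) v) + h (frechet_derivative f (at x) v) (g x))"
      for v
      using Suc.prems \<open>C_k k f\<close> \<open>C_k k g\<close> by (intro C_k_add Suc.IH) simp_all
  qed
qed

lemma C_infinity_const: "C_infinity (\<lambda>x. c)"
  by (simp add: C_infinity_def C_k_const)

lemma C_infinity_add: "C_infinity f \<Longrightarrow> C_infinity g \<Longrightarrow> C_infinity (\<lambda>x. f x + g x)"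
  by (simp add: C_infinity_def C_k_add)

lemma C_infinity_bounded_linear:
  "bounded_linear h \<Longrightarrow> C_infinity f \<Longrightarrow> C_infinity (\<lambda>x. h (f x))"
  by (simp add: C_infinity_def C_k_bounded_linear)

lemma C_infinity_bounded_bilinear:
  "bounded_bilinear h \<Longrightarrow> C_infinity f \<Longrightarrow> C_infinity g \<Longrightarrow> C_infinity (\<lambda>x. h (f x) (g x))"
  by (simp add: C_infinity_def C_k_bounded_bilinear)

lemma C_infinity_sum:
  "(\<And>i. i \<in> I \<Longrightarrow> C_infinity (f i)) \<Longrightarrow> C_infinity (\<lambda>x. \<Sum>i\<in>I. f i x)"
  by (induction I rule: infinite_finite_induct) (simp_all add: C_infinity_const C_infinity_add)

lemma C_infinity_prod:
  fixes f :: "'i \<Rightarrow> 'a::euclidean_space \<Rightarrow> real"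
  shows "(\<And>i. i \<in> I \<Longrightarrow> C_infinity (f i)) \<Longrightarrow> C_infinity (\<lambda>x. \<Prod>i\<in>I. f i x)"
  by (induction I rule: infinite_finite_induct)
     (simp_all add: C_infinity_const C_infinity_bounded_bilinear[OF bounded_bilinear_mult])

text \<open>The Leibniz expansion is a polynomial in the entries. This makes both sides of Cramer's
  rule smooth on the whole space.\<close>

lemma C_infinity_det:
  fixes B :: "'a::euclidean_space \<Rightarrow> real ^ 'm ^ 'm"
  assumes "\<And>i j. C_infinity (\<lambda>x. B x $ i $ j)"
  shows "C_infinity (\<lambda>x. det (B x))"
  unfolding det_def
  by (intro C_infinity_sum C_infinity_bounded_bilinear[OF bounded_bilinear_mult]
      C_infinity_const C_infinity_prod assms)

lemma C_infinity_continuous: "C_infinity f \<Longrightarrow> continuous_on S f"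
  unfolding C_infinity_def by (metis C_k.simps(1) continuous_on_subset subset_UNIV)

lemma C_infinity_has_derivative:
  "C_infinity f \<Longrightarrow> (f has_derivative frechet_derivative f (at x)) (at x)"
  unfolding C_infinity_def by (metis C_k_Suc_has_derivative)

lemma C_infinity_frechet_derivative:
  "C_infinity f \<Longrightarrow> C_infinity (\<lambda>x. frechet_derivative f (at x) v)"
  unfolding C_infinity_def by (metis C_k.simps(2))

subsection \<open>Flatness on zero sets\<close>

text \<open>Each ball of the family meets \<open>T\<close> only in its centre, so a countable
  Lindelof subfamily already has every point of \<open>T\<close> as a centre.\<close>

lemma countable_isolated:
  fixes T :: "'a::{metric_space,second_countable_topology} set"
  assumes "\<And>t. t \<in> T \<Longrightarrow> \<exists>e>0. \<forall>s\<in>T. dist s t < e \<longrightarrow> s = t"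
  shows "countable T"
proof -
  obtain e where *: "\<forall>t\<in>T. e t > 0 \<and> (\<forall>s\<in>T. dist s t < e t \<longrightarrow> s = t)"
    using bchoice[of T "\<lambda>t e. e > 0 \<and> (\<forall>s\<in>T. dist s t < e \<longrightarrow> s = t)"] assms by auto
  then have e: "\<And>t. t \<in> T \<Longrightarrow> e t > 0" "\<And>t s. t \<in> T \<Longrightarrow> s \<in> T \<Longrightarrow> dist s t < e t \<Longrightarrow> s = t"
    by auto
  define \<F> where "\<F> = (\<lambda>t. ball t (e t)) ` T"
  have "open S" if "S \<in> \<F>" for S
    using that by (auto simp: \<F>_def)
  then obtain \<F>' where F: "\<F>' \<subseteq> \<F>" "countable \<F>'" "\<Union>\<F>' = \<Union>\<F>"
    by (rule Lindelof)
  obtain T' where T': "T' \<subseteq> T" "countable T'" "\<F>' = (\<lambda>t. ball t (e t)) ` T'"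
    using F(1,2) countable_subset_image[of \<F>' "\<lambda>t. ball t (e t)" T] by (auto simp: \<F>_def)
  have "T \<subseteq> T'"
  proof
    fix t assume t: "t \<in> T"
    then have "t \<in> \<Union>\<F>'"
      unfolding F(3) \<F>_def using e(1)[OF t] t by (auto intro!: bexI[of _ t])
    then obtain s where "s \<in> T'" "dist t s < e s"
      using T'(3) by (auto simp: dist_commute)
    then show "t \<in> T'"
      using e(2) t T'(1) by (metis subsetD)
  qed
  then show ?thesis
    using T'(2) countable_subset by blast
qed

lemma countable_simple_zeros:
  fixes \<phi> :: "real \<Rightarrow> 'b::real_normed_vector"
  assumes "\<And>t. (\<phi> has_vector_derivative \<phi>' t) (at t)"
  shows "countable {t. \<phi> t = 0 \<and> \<phi>' t \<noteq> 0}"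
proof (rule countable_isolated)
  fix t assume t: "t \<in> {t. \<phi> t = 0 \<and> \<phi>' t \<noteq> 0}"
  then have "norm (\<phi>' t) / 2 > 0" by simp
  moreover have "(\<phi> has_derivative (\<lambda>h. h *\<^sub>R \<phi>' t)) (at t)"
    using assms by (simp add: has_vector_derivative_def)
  ultimately obtain e where e: "e > 0" "\<And>s. norm (s - t) < e \<Longrightarrow>
      norm (\<phi> s - \<phi> t - (s - t) *\<^sub>R \<phi>' t) \<le> norm (\<phi>' t) / 2 * norm (s - t)"
    unfolding has_derivative_at_alt by metis
  have "s = t" if s: "\<phi> s = 0" "dist s t < e" for s
  proof -
    \<comment> \<open>Both values of \<open>\<phi>\<close> vanish, so the first-order remainder is
      the linear term itself; a tolerance of half its slope leaves only
      \<open>s = t\<close>.\<close>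
    have "\<bar>s - t\<bar> * norm (\<phi>' t) \<le> norm (\<phi>' t) / 2 * \<bar>s - t\<bar>"
      using e(2)[of s] s t by (simp add: dist_norm)
    then show ?thesis
      using t by (auto simp: field_simps mult_le_0_iff)
  qed
  then show "\<exists>e>0. \<forall>s\<in>{t. \<phi> t = 0 \<and> \<phi>' t \<noteq> 0}. dist s t < e \<longrightarrow> s = t"
    using e(1) by auto
qed

text \<open>On every line parallel to \<open>v\<close> the exceptional points are simple zeros,
  hence countable, and Fubini makes the exceptional set null.\<close>

lemma AE_derivative_zero_on_zero_set:
  fixes w :: "'a::euclidean_space \<Rightarrow> 'b::euclidean_space"
  assumes "C_k (Suc 0) w"
  shows "AE x in lborel. w x = 0 \<longrightarrow> frechet_derivative w (at x) v = 0"
proof -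
  define D where "D x = frechet_derivative w (at x) v" for x
  define S where "S = {x. w x = 0 \<and> D x \<noteq> 0}"
  have "continuous_on UNIV w" "continuous_on UNIV D"
    using assms C_k_Suc_imp_C_k[OF assms] by (simp_all add: D_def)
  then have [measurable]: "w \<in> borel_measurable borel" "D \<in> borel_measurable borel"
    by (auto intro: borel_measurable_continuous_onI)
  have [measurable]: "S \<in> sets borel"
    unfolding S_def by measurable
  \<comment> \<open>Translating by all multiples of \<open>v\<close> replaces coordinates adapted to
    \<open>v\<close>: the measure of \<open>S\<close> times the infinite length of the line becomes
    a double integral, and exchanging its order gives 0.\<close>
  have "emeasure lborel S * emeasure lborel (UNIV :: real set)
      = (\<integral>\<^sup>+ t. emeasure lborel S \<partial>(lborel :: real measure))"
    by simp
  also have "\<dots> = (\<integral>\<^sup>+ t. (\<integral>\<^sup>+ x. indicator S (t *\<^sub>R v + x) \<partial>lborel) \<partial>(lborel :: real measure))"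
  proof (intro nn_integral_cong)
    fix t :: real
    have "emeasure lborel S = (\<integral>\<^sup>+ x. indicator S x \<partial>distr lborel borel ((+) (t *\<^sub>R v)))"
      unfolding lborel_distr_plus by simp
    also have "\<dots> = (\<integral>\<^sup>+ x. indicator S (t *\<^sub>R v + x) \<partial>lborel)"
      by (subst nn_integral_distr) simp_all
    finally show "emeasure lborel S = (\<integral>\<^sup>+ x. indicator S (t *\<^sub>R v + x) \<partial>lborel)"
      .
  qed
  also have "\<dots> = (\<integral>\<^sup>+ x. (\<integral>\<^sup>+ t. indicator S (t *\<^sub>R v + x) \<partial>(lborel :: real measure)) \<partial>lborel)"
    by (rule lborel_pair.Fubini') measurable
  also have "\<dots> = (\<integral>\<^sup>+ x. 0 \<partial>(lborel :: 'a measure))"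
  proof (intro nn_integral_cong)
    fix x :: 'a
    have "((\<lambda>t. w (t *\<^sub>R v + x)) has_vector_derivative D (t *\<^sub>R v + x)) (at t)" for t
    proof -
      have "((\<lambda>t. t *\<^sub>R v + x) has_derivative (\<lambda>h. h *\<^sub>R v)) (at t)"
        by (auto intro!: derivative_eq_intros)
      from has_derivative_compose[OF this C_k_Suc_has_derivative[OF assms]] show ?thesis
        using linear_cmul[OF has_derivative_linear[OF C_k_Suc_has_derivative[OF assms]]]
        by (simp add: has_vector_derivative_def D_def)
    qed
    from countable_simple_zeros[OF this]
    have "countable {t. t *\<^sub>R v + x \<in> S}"
      by (simp add: S_def)
    then have "{t. t *\<^sub>R v + x \<in> S} \<in> null_sets lborel"
      by (rule countable_imp_null_set_lborel)
    then have "emeasure lborel {t. t *\<^sub>R v + x \<in> S} = 0"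
      by auto
    moreover have "(\<integral>\<^sup>+ t. indicator S (t *\<^sub>R v + x) \<partial>lborel) = (\<integral>\<^sup>+ t. indicator {t. t *\<^sub>R v + x \<in> S} t \<partial>(lborel :: real measure))"
      by (intro nn_integral_cong) (auto simp: indicator_def)
    ultimately show "(\<integral>\<^sup>+ t. indicator S (t *\<^sub>R v + x) \<partial>(lborel :: real measure)) = 0"
      by simp
  qed
  finally have "emeasure lborel S = 0"
    by (simp add: emeasure_lborel_UNIV)
  then have "S \<in> null_sets lborel"
    by auto
  then show ?thesis
    by (rule AE_I') (auto simp: S_def D_def)
qed

text \<open>Induction on \<open>m\<close>: almost everywhere on \<open>R\<close> the directional
  derivatives vanish as well, so they are flat to order \<open>m\<close>, and the mean value
  inequality gains one order.\<close>

lemma AE_flat_on_zero_set: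
  fixes w :: "'a::euclidean_space \<Rightarrow> 'b::euclidean_space"
  assumes "C_k m w" and "AE x in lborel. x \<in> R \<longrightarrow> w x = 0"
  shows "AE x in lborel. x \<in> R \<longrightarrow> (\<exists>C\<ge>0. \<exists>d>0. \<forall>z. dist z x < d \<longrightarrow> norm (w z) \<le> C * dist z x ^ m)"
  using assms
proof (induction m arbitrary: w)
  case 0
  have "\<exists>C\<ge>0. \<exists>d>0. \<forall>z. dist z x < d \<longrightarrow> norm (w z) \<le> C * dist z x ^ 0" for x
  proof -
    have "isCont w x"
      using 0 by (simp add: continuous_on_eq_continuous_at)
    then obtain d where "d > 0" "\<And>z. dist z x < d \<Longrightarrow> dist (w z) (w x) < 1"
      unfolding continuous_at_eps_delta by (metis zero_less_one)
    then have "norm (w z) \<le> (norm (w x) + 1) * dist z x ^ 0" if "dist z x < d" for z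
      using that norm_triangle_ineq2[of "w z" "w x"] by (fastforce simp: dist_norm)
    then show ?thesis
      using \<open>d > 0\<close> by (intro exI[of _ "norm (w x) + 1"]) auto
  qed
  then show ?case by simp
next
  case (Suc m)
  let ?D = "\<lambda>x v. frechet_derivative w (at x) v"
  have C1: "C_k (Suc 0) w"
    using Suc.prems(1)
  proof (induction m)
    case (Suc m)
    then show ?case using C_k_Suc_imp_C_k by blast
  qed
  have "AE x in lborel. x \<in> R \<longrightarrow> ?D x v = 0" for v
    using AE_derivative_zero_on_zero_set[OF C1, of v] Suc.prems(2) by eventually_elim auto
  with Suc have "AE x in lborel. x \<in> R \<longrightarrow>
      (\<exists>C\<ge>0. \<exists>d>0. \<forall>z. dist z x < d \<longrightarrow> norm (?D z v) \<le> C * dist z x ^ m)" for v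
    by simp
  then have "AE x in lborel. \<forall>v\<in>Basis. x \<in> R \<longrightarrow>
      (\<exists>C\<ge>0. \<exists>d>0. \<forall>z. dist z x < d \<longrightarrow> norm (?D z v) \<le> C * dist z x ^ m)"
    by (subst AE_finite_all) auto
  with Suc.prems(2) show ?case
  proof eventually_elim
    case (elim x)
    show ?case
    proof
      assume "x \<in> R"
      with elim have w0: "w x = 0" by simp
      from elim \<open>x \<in> R\<close> obtain C d where C: "\<And>v. v \<in> Basis \<Longrightarrow> C v \<ge> 0" and d: "\<And>v. v \<in> Basis \<Longrightarrow> d v > 0"
        and bd: "\<And>v z. v \<in> Basis \<Longrightarrow> dist z x < d v \<Longrightarrow> norm (?D z v) \<le> C v * dist z x ^ m"
        by metis
      define \<delta> where "\<delta> = Min (d ` Basis)"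
      define K where "K = (\<Sum>v\<in>Basis. C v)"
      have \<delta>: "\<delta> > 0" "\<And>v. v \<in> Basis \<Longrightarrow> \<delta> \<le> d v"
        using d by (auto simp: \<delta>_def)
      have K0: "K \<ge> 0" using C by (auto simp: K_def intro: sum_nonneg)
      have "norm (w z) \<le> K * dist z x ^ Suc m" if z: "dist z x < \<delta>" for z
      proof -
        \<comment> \<open>No point of this closed ball is farther from \<open>x\<close> than
          \<open>z\<close> is, so the order \<open>m\<close> bound on the derivative holds
          throughout with \<open>dist z x\<close>.\<close>
        have "norm (w z - w x) \<le> (K * dist z x ^ m) * norm (z - x)"
        proof (rule differentiable_bound)
          show "convex (cball x (dist z x))" by simp
          show "(w has_derivative ?D y) (at y within cball x (dist z x))" for y
            using C_k_Suc_has_derivative[OF C1] has_derivative_at_withinI by blast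
          show "z \<in> cball x (dist z x)" "x \<in> cball x (dist z x)"
            by (auto simp: dist_commute)
          fix y assume "y \<in> cball x (dist z x)"
          then have y: "dist y x \<le> dist z x" by (simp add: dist_commute)
          show "onorm (?D y) \<le> K * dist z x ^ m"
          proof (rule onorm_le)
            fix u
            have lin: "linear (?D y)"
              using C_k_Suc_has_derivative[OF C1] has_derivative_linear by blast
            have "?D y u = (\<Sum>v\<in>Basis. (u \<bullet> v) *\<^sub>R ?D y v)"
              by (subst (1) euclidean_representation[of u, symmetric])
                 (simp add: linear_sum[OF lin] linear_cmul[OF lin] o_def)
            also have "norm \<dots> \<le> (\<Sum>v\<in>Basis. C v * dist z x ^ m * norm u)"
            proof (rule sum_norm_le)
              fix v :: 'a assume v: "v \<in> Basis"
              have "norm (?D y v) \<le> C v * dist y x ^ m"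
                using bd[OF v] y z \<delta>(2)[OF v] by force
              also have "\<dots> \<le> C v * dist z x ^ m"
                using y C[OF v] by (intro mult_left_mono power_mono) auto
              finally have "norm (?D y v) \<le> C v * dist z x ^ m" .
              then have "\<bar>u \<bullet> v\<bar> * norm (?D y v) \<le> norm u * (C v * dist z x ^ m)"
                using Basis_le_norm[OF v] by (intro mult_mono) auto
              then show "norm ((u \<bullet> v) *\<^sub>R ?D y v) \<le> C v * dist z x ^ m * norm u"
                by (simp add: mult.commute)
            qed
            also have "\<dots> = K * dist z x ^ m * norm u"
              by (simp add: K_def sum_distrib_right)
            finally show "norm (?D y u) \<le> K * dist z x ^ m * norm u" .
          qed
        qed
        then show ?thesis
          by (simp add: w0 dist_norm mult_ac)
      qed
      with K0 \<delta>(1) show "\<exists>C\<ge>0. \<exists>d>0. \<forall>z. dist z x < d \<longrightarrow> norm (w z) \<le> C * dist z x ^ Suc m"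
        by blast
    qed
  qed
qed

subsection \<open>Straightening the map at a point\<close>

text \<open>\<open>q\<close> records the grid cell of the orthonormal coordinates. Phrasing the
  cover as a colouring lets two of them be combined into pairs; a colour class plays the role of a
  covering ball.\<close>

lemma subspace_quantization:
  fixes T :: "'a::euclidean_space set"
  assumes "subspace T" and "R \<ge> 0"
  obtains K where "K \<ge> 0" and "\<And>s. 0 < s \<Longrightarrow> s \<le> 1 \<Longrightarrow>
    \<exists>q :: 'a \<Rightarrow> 'a \<Rightarrow> int. finite (q ` (T \<inter> cball 0 R)) \<and>
      real (card (q ` (T \<inter> cball 0 R))) \<le> K * (1 / s) ^ dim T \<and>
      (\<forall>u\<in>T. \<forall>v\<in>T. q u = q v \<longrightarrow> norm (u - v) \<le> s)"
proof -
  obtain B where B: "B \<subseteq> T" "pairwise orthogonal B" "\<And>x. x \<in> B \<Longrightarrow> norm x = 1"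
      "independent B" "card B = dim T" "span B = T"
    using orthonormal_basis_subspace[OF assms(1)] by metis
  have finB: "finite B"
    using B(4) independent_imp_finite by blast
  have expand: "u = (\<Sum>b\<in>B. (u \<bullet> b) *\<^sub>R b)" if "u \<in> T" for u
    using orthonormal_basis_expand[of B u] B that finB by simp
  \<comment> \<open>The grid has mesh \<open>s / N\<close>, so \<open>dim T\<close> coordinate
    errors add up to at most \<open>s\<close>; the summand 1 keeps \<open>N\<close> positive when
    \<open>dim T = 0\<close>.\<close>
  define N where "N = real (dim T) + 1"
  show thesis
  proof
    show "(2 * (R * N) + 3) ^ dim T \<ge> 0"
      using assms(2) by (simp add: N_def)
    fix s :: real assume s: "0 < s" "s \<le> 1"
    define q where "q u = restrict (\<lambda>b. \<lfloor>(u \<bullet> b) * N / s\<rfloor>) B" for u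
    define m where "m = \<lceil>R * N / s\<rceil>"
    have N: "N > 0" by (simp add: N_def)
    have "m \<ge> 0"
      unfolding m_def using assms(2) s N by (smt (verit) divide_nonneg_pos mult_nonneg_nonneg zero_le_ceiling)
    have sub: "q ` (T \<inter> cball 0 R) \<subseteq> B \<rightarrow>\<^sub>E {-m..m}"
    proof (intro image_subsetI PiE_I)
      fix u b assume u: "u \<in> T \<inter> cball 0 R" and b: "b \<in> B"
      have "\<bar>u \<bullet> b\<bar> \<le> R"
        using Cauchy_Schwarz_ineq2[of u b] B(3)[OF b] u by simp
      then have *: "\<bar>(u \<bullet> b) * N / s\<bar> \<le> R * N / s"
        using N s by (simp add: abs_mult divide_right_mono mult_right_mono)
      have "\<lfloor>X\<rfloor> \<in> {- \<lceil>Y\<rceil>..\<lceil>Y\<rceil>}" if "\<bar>X\<bar> \<le> Y" for X Y :: real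
        using that by (simp add: abs_le_iff) linarith
      from this[OF *] show "q u b \<in> {-m..m}"
        using b by (simp add: q_def m_def)
    qed (auto simp: q_def)
    have fin: "finite (B \<rightarrow>\<^sub>E {-m..m})"
      using finB by (intro finite_PiE) auto
    have "real (card (q ` (T \<inter> cball 0 R))) \<le> real (card (B \<rightarrow>\<^sub>E {-m..m}))"
      using card_mono[OF fin sub] by simp
    also have "\<dots> = (real_of_int (2 * m + 1)) ^ dim T"
      using \<open>m \<ge> 0\<close> finB B(5) by (simp add: card_PiE)
    also have "\<dots> \<le> ((2 * (R * N) + 3) * (1 / s)) ^ dim T"
    proof (rule power_mono)
      have "real_of_int m \<le> R * N / s + 1"
        unfolding m_def by linarith
      then have "real_of_int (2 * m + 1) \<le> 2 * (R * N) / s + 3"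
        by simp
      also have "3 \<le> 3 / s"
        using s by (simp add: field_simps)
      then have "2 * (R * N) / s + 3 \<le> (2 * (R * N) + 3) * (1 / s)"
        by (simp add: add_divide_distrib)
      finally show "real_of_int (2 * m + 1) \<le> (2 * (R * N) + 3) * (1 / s)" .
    qed (use \<open>m \<ge> 0\<close> in simp)
    also have "\<dots> = (2 * (R * N) + 3) ^ dim T * (1 / s) ^ dim T"
      by (rule power_mult_distrib)
    finally have card: "real (card (q ` (T \<inter> cball 0 R))) \<le> (2 * (R * N) + 3) ^ dim T * (1 / s) ^ dim T" .
    have "norm (u - v) \<le> s" if "u \<in> T" "v \<in> T" "q u = q v" for u v
    proof -
      have "u - v \<in> T"
        using assms(1) that by (simp add: subspace_diff)
      then have "norm (u - v) = norm (\<Sum>b\<in>B. ((u - v) \<bullet> b) *\<^sub>R b)"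
        using expand[of "u - v"] by simp
      also have "\<dots> \<le> (\<Sum>b\<in>B. s / N)"
      proof (rule sum_norm_le)
        fix b assume b: "b \<in> B"
        have "\<lfloor>(u \<bullet> b) * N / s\<rfloor> = \<lfloor>(v \<bullet> b) * N / s\<rfloor>"
          using fun_cong[OF that(3), of b] b by (simp add: q_def)
        then have "\<bar>(u \<bullet> b) * N / s - (v \<bullet> b) * N / s\<bar> \<le> 1"
          by linarith
        then have "\<bar>(u - v) \<bullet> b\<bar> * (N / s) \<le> 1"
          using N s by (simp add: inner_diff_left abs_mult flip: diff_divide_distrib left_diff_distrib)
        then show "norm (((u - v) \<bullet> b) *\<^sub>R b) \<le> s / N"
          using N s B(3)[OF b] by (simp add: field_simps)
      qed
      also have "\<dots> = s * (real (dim T) / N)"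
        using B(5) by simp
      also have "\<dots> \<le> s * 1"
        using s by (intro mult_left_mono) (auto simp: N_def)
      finally show ?thesis by simp
    qed
    with card show "\<exists>q :: 'a \<Rightarrow> 'a \<Rightarrow> int. finite (q ` (T \<inter> cball 0 R)) \<and>
      real (card (q ` (T \<inter> cball 0 R))) \<le> (2 * (R * N) + 3) ^ dim T * (1 / s) ^ dim T \<and>
      (\<forall>u\<in>T. \<forall>v\<in>T. q u = q v \<longrightarrow> norm (u - v) \<le> s)"
      using finite_subset[OF sub fin] by (intro exI[of _ q]) auto
  qed
qed

text \<open>A right inverse \<open>g\<close> of \<open>A\<close> on its range gives the first
  identity; passing to \<open>g \<circ> A \<circ> g\<close> secures the second and keeps the
  first.\<close>

lemma linear_generalized_inverse:
  fixes A :: "'a::euclidean_space \<Rightarrow> 'b::euclidean_space"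
  assumes "linear A"
  obtains L where "linear L" "\<And>w. A (L (A w)) = A w" "\<And>y. L (A (L y)) = L y"
proof -
  obtain g where g: "linear g" "\<forall>v\<in>range A. A (g v) = v"
    using linear_exists_right_inverse_on[OF assms subspace_UNIV] by auto
  show thesis
  proof
    show "linear (\<lambda>y. g (A (g y)))"
      using linear_compose[OF g(1) linear_compose[OF assms g(1)]] g(1)
        linear_compose[OF linear_compose[OF g(1) assms] g(1)] by (simp add: o_def)
  qed (use g in auto)
qed

text \<open>The image of a basis of \<open>S\<close> spans the image of \<open>S\<close>, whose
  dimension leaves no room for repetitions or relations. Hence \<open>L\<close> is injective on
  \<open>S\<close>.\<close>

lemma linear_kernel_trivial_of_dim_image:
  fixes L :: "'a::euclidean_space \<Rightarrow> 'b::euclidean_space"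
  assumes "linear L" "subspace S" "dim S \<le> dim (L ` S)" "y \<in> S" "L y = 0"
  shows "y = 0"
proof -
  obtain B where B: "B \<subseteq> S" "independent B" "S \<subseteq> span B" "card B = dim S"
    using basis_exists by metis
  have fin: "finite B"
    using B(2) independent_imp_finite by blast
  have span: "span (L ` B) = L ` S"
    using B assms(2) by (metis linear_span_image[OF assms(1)] span_subspace)
  have cardle: "dim (L ` S) \<le> card (L ` B)"
    using fin by (metis span dim_span dim_le_card' finite_imageI)
  have "card (L ` B) \<le> card B"
    using fin by (rule card_image_le)
  then have eq: "card (L ` B) = card B"
    using cardle assms(3) B(4) by linarith
  then have "inj_on L B"
    using fin by (rule eq_card_imp_inj_on[rotated])
  moreover have "independent (L ` B)"
  proof (rule card_le_dim_spanning)
    show "L ` B \<subseteq> L ` S" using B(1) by blast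
    show "L ` S \<subseteq> span (L ` B)" using span by blast
    show "finite (L ` B)" using fin by simp
    show "card (L ` B) \<le> dim (L ` S)" using eq assms(3) B(4) by linarith
  qed
  ultimately have "inj_on L (span B)"
    using linear_inj_on_span_independent_image[OF assms(1)] by blast
  then show ?thesis
    using assms(1,4,5) B(3) by (metis inj_onD linear_0 span_zero subsetD)
qed

text \<open>The chart \<open>G\<close> straightens \<open>f\<close> near \<open>x0\<close>: the generalized inverse \<open>L\<close> of the differential
  at \<open>x0\<close> splits the domain as \<open>ker \<oplus> range L\<close>, and \<open>G\<close> replaces the component in \<open>range L\<close>
  by \<open>L \<circ> f\<close>.\<close>

locale straightening_chart =
  fixes f :: "'a::euclidean_space \<Rightarrow> 'b::euclidean_space" and x0 :: 'a and L :: "'b \<Rightarrow> 'a"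
  assumes smooth: "C_infinity f"
    and linear_L: "linear L"
    and ALA: "\<And>w. frechet_derivative f (at x0) (L (frechet_derivative f (at x0) w))
                    = frechet_derivative f (at x0) w"
    and LAL: "\<And>y. L (frechet_derivative f (at x0) (L y)) = L y"
begin

definition A :: "'a \<Rightarrow> 'a \<Rightarrow> 'b" where "A z = frechet_derivative f (at z)"
definition ker :: "'a set" where "ker = {w. A x0 w = 0}"
text \<open>The projection onto \<open>ker\<close> along \<open>range L\<close>.\<close>

definition P :: "'a \<Rightarrow> 'a" where "P w = w - L (A x0 w)"
definition G :: "'a \<Rightarrow> 'a" where "G x = L (f x) + P x"
text \<open>The derivative of the chart \<open>G\<close> at \<open>z\<close>; it is the identity at
  \<open>x0\<close>.\<close>

definition B :: "'a \<Rightarrow> 'a \<Rightarrow> 'a" where "B z w = L (A z w) + P w"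

lemma f_deriv: "(f has_derivative A z) (at z)"
  unfolding A_def by (rule C_infinity_has_derivative[OF smooth])

lemma linear_A: "linear (A z)"
  using f_deriv has_derivative_linear by blast

lemma linear_P: "linear P"
  unfolding P_def
  using linear_compose_sub[OF linear_id linear_compose[OF linear_A linear_L]] by (simp add: o_def id_def)

lemma linear_B: "linear (B z)"
  unfolding B_def
  using linear_compose_add[OF linear_compose[OF linear_A linear_L] linear_P] by (simp add: o_def)

lemma P_in_ker: "P w \<in> ker"
  using ALA by (simp add: P_def ker_def linear_diff[OF linear_A] flip: A_def)

lemma P_ker: "w \<in> ker \<Longrightarrow> P w = w"
  by (simp add: P_def ker_def linear_0[OF linear_L])

lemma P_L: "P (L y) = 0"
  using LAL by (simp add: P_def A_def)

lemma subspace_ker: "subspace ker"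
  unfolding ker_def using linear_A by (rule linear_subspace_kernel)

lemma subspace_range_L: "subspace (range L)"
  using linear_L linear_subspace_image subspace_UNIV by blast

text \<open>By the two identities, \<open>A x0\<close> maps \<open>range L\<close> onto its own
  range and \<open>L\<close> maps that range back onto \<open>range L\<close>; each gives one
  inequality.\<close>

lemma dim_range_L: "dim (range L) = differential_rank f x0"
proof (rule antisym)
  have "range L \<subseteq> L ` range (A x0)"
    using LAL by (auto simp: A_def) (metis rangeI image_eqI)
  then have "dim (range L) \<le> dim (L ` range (A x0))"
    by (rule dim_subset)
  also have "\<dots> \<le> dim (range (A x0))"
    using linear_L by (rule dim_image_le)
  finally show "dim (range L) \<le> differential_rank f x0"
    by (simp add: differential_rank_def A_def)
  have "range (A x0) \<subseteq> A x0 ` range L"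
    using ALA by (auto simp: A_def) (metis rangeI image_eqI)
  then have "dim (range (A x0)) \<le> dim (A x0 ` range L)"
    by (rule dim_subset)
  also have "\<dots> \<le> dim (range L)"
    using linear_A by (rule dim_image_le)
  finally show "differential_rank f x0 \<le> dim (range L)"
    by (simp add: differential_rank_def A_def)
qed

lemma dim_ker: "dim ker + differential_rank f x0 = DIM('a)"
proof -
  have int: "ker \<inter> range L = {0}"
  proof -
    have "w = 0" if "w \<in> ker" "w \<in> range L" for w
      using that P_ker P_L by (metis imageE)
    then show ?thesis
      using subspace_0[OF subspace_ker] subspace_0[OF subspace_range_L] by blast
  qed
  have sum: "{x + y |x y. x \<in> ker \<and> y \<in> range L} = UNIV"
  proof -
    have "w = P w + L (A x0 w)" for w by (simp add: P_def)
    then show ?thesis using P_in_ker by blast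
  qed
  show ?thesis
    using dim_sums_Int[OF subspace_ker subspace_range_L] dim_range_L
    by (simp add: int sum)
qed

section \<open>Bi-Lipschitz behaviour of the chart\<close>

lemma G_deriv: "(G has_derivative B z) (at z)"
  unfolding G_def B_def
  by (intro has_derivative_add bounded_linear.has_derivative[OF _ f_deriv]
      bounded_linear_imp_has_derivative) (simp_all add: linear_L linear_P linear_conv_bounded_linear[symmetric])

lemma B_x0: "B x0 w = w"
  by (simp add: B_def P_def)

text \<open>Bundled as a bounded linear function so that continuity refers to the operator norm, as
  the inverse function theorem requires.\<close>

definition BB :: "'a \<Rightarrow> 'a \<Rightarrow>\<^sub>L 'a" where "BB z = Blinfun (B z)"

lemma BB_apply: "blinfun_apply (BB z) = B z"
  unfolding BB_def using linear_B by (simp add: bounded_linear_Blinfun_apply linear_conv_bounded_linear)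

lemma continuous_A: "continuous_on UNIV (\<lambda>z. A z w)"
  unfolding A_def by (intro C_infinity_continuous C_infinity_frechet_derivative smooth)

lemma continuous_B: "continuous_on UNIV (\<lambda>z. B z w)"
  unfolding B_def using linear_continuous_on_compose[OF continuous_A linear_L]
  by (intro continuous_on_add) (simp_all add: o_def)

lemma continuous_BB: "continuous_on UNIV BB"
  by (rule continuous_on_blinfun_componentwise) (simp add: BB_apply continuous_B)

lemma B_near_id:
  obtains d where "d > 0" "\<And>z w. z \<in> ball x0 d \<Longrightarrow> norm (B z w - w) \<le> norm w / 2"
proof -
  have "isCont BB x0"
    using continuous_BB by (simp add: continuous_on_eq_continuous_at)
  then obtain d where "d > 0" and d: "\<And>z. dist z x0 < d \<Longrightarrow> dist (BB z) (BB x0) < 1 / 2"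
    unfolding continuous_at_eps_delta by (metis half_gt_zero zero_less_one)
  have "norm (B z w - w) \<le> norm w / 2" if "z \<in> ball x0 d" for z w
  proof -
    have "norm (B z w - w) = norm (blinfun_apply (BB z - BB x0) w)"
      by (simp add: blinfun.diff_left BB_apply B_x0)
    also have "\<dots> \<le> norm (BB z - BB x0) * norm w"
      by (rule norm_blinfun)
    also have "\<dots> \<le> 1 / 2 * norm w"
      using d[of z] that by (intro mult_right_mono) (auto simp: dist_norm norm_minus_commute)
    finally show ?thesis by simp
  qed
  with \<open>d > 0\<close> show thesis by (rule that)
qed

text \<open>Mean value inequality for \<open>G\<close> minus the identity, whose derivative has norm
  at most 1/2 on the convex ball.\<close>

lemma G_bilipschitz:
  assumes "\<And>z w. z \<in> ball x0 d \<Longrightarrow> norm (B z w - w) \<le> norm w / 2"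
    and "x \<in> ball x0 d" "x' \<in> ball x0 d"
  shows "norm (G x - G x' - (x - x')) \<le> norm (x - x') / 2"
proof -
  have "((\<lambda>x. G x - x) has_derivative (\<lambda>w. B z w - w)) (at z within ball x0 d)" for z
    by (rule has_derivative_at_withinI[OF has_derivative_diff[OF G_deriv has_derivative_ident]])
  moreover have "onorm (\<lambda>w. B z w - w) \<le> 1 / 2" if "z \<in> ball x0 d" for z
    by (rule onorm_le) (use assms(1)[OF that] in simp)
  ultimately have "norm ((G x - x) - (G x' - x')) \<le> 1 / 2 * norm (x - x')"
    using differentiable_bound[of "ball x0 d" "\<lambda>x. G x - x" "\<lambda>z w. B z w - w" "1/2" x x'] assms(2,3)
    by simp
  then show ?thesis by (simp add: algebra_simps)
qed

text \<open>If the rank does not exceed the rank at \<open>x0\<close>, then \<open>L\<close> is injective on the range of the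
  differential, while \<open>L (A z w) = 0\<close> by the choice of \<open>w\<close>.\<close>

lemma derivative_vanishes_on_B_preimage_ker:
  assumes "differential_rank f z \<le> differential_rank f x0"
    and "surj (B z)" "B z w \<in> ker"
  shows "A z w = 0"
proof -
  \<comment> \<open>\<open>A x0\<close> kills \<open>P w\<close>, and \<open>L \<circ> A x0\<close>
    is the identity on \<open>range L\<close>, so the \<open>range L\<close> component of
    \<open>B z w\<close> is \<open>L (A z w)\<close>.\<close>
  have LA: "L (A x0 (B z w)) = L (A z w)" for w
    using P_in_ker[of w] LAL
    by (simp add: B_def linear_add[OF linear_A] linear_add[OF linear_L] ker_def linear_0[OF linear_L] flip: A_def)
  \<comment> \<open>Since \<open>B z\<close> is onto, \<open>L \<circ> A z\<close> already fills
    \<open>range L\<close>; by the rank hypothesis \<open>L\<close> then preserves the dimension of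
    \<open>range (A z)\<close>.\<close>
  have "range L \<subseteq> L ` range (A z)"
  proof
    fix v assume "v \<in> range L"
    then obtain y where "v = L y" by blast
    moreover obtain w where "B z w = L y"
      using assms(2) by (metis surjD)
    ultimately have "v = L (A z w)"
      using LA[of w] LAL by (simp add: A_def)
    then show "v \<in> L ` range (A z)" by blast
  qed
  then have "dim (range (A z)) \<le> dim (L ` range (A z))"
    using dim_subset[of "range L" "L ` range (A z)"] dim_range_L assms(1)
    by (simp add: differential_rank_def A_def)
  moreover have "L (A z w) = 0"
    using LA[of w] assms(3) by (simp add: ker_def linear_0[OF linear_L])
  ultimately show ?thesis
    using linear_kernel_trivial_of_dim_image[OF linear_L linear_subspace_image[OF linear_A subspace_UNIV]]
    by blast
qed

end

lemma straightening_chart_exists: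
  fixes f :: "'a::euclidean_space \<Rightarrow> 'b::euclidean_space"
  assumes "C_infinity f"
  obtains L where "straightening_chart f x0 L"
proof -
  have "linear (frechet_derivative f (at x0))"
    using C_infinity_has_derivative[OF assms] has_derivative_linear by blast
  then show thesis
    using linear_generalized_inverse assms that unfolding straightening_chart_def by metis
qed

subsection \<open>Comparing finite measures on balls\<close>

text \<open>A countable Lindelof subfamily of the balls covers \<open>R\<close>, so only countably
  many null sets are united.\<close>

lemma AE_from_local:
  fixes R :: "'a::euclidean_space set"
  assumes "\<And>x0. x0 \<in> R \<Longrightarrow> \<exists>d>0. AE x in M. x \<in> ball x0 d \<longrightarrow> x \<in> R \<longrightarrow> Q x"
  shows "AE x in M. x \<in> R \<longrightarrow> Q x"
proof -
  obtain d where d: "\<forall>x0\<in>R. d x0 > 0 \<and> (AE x in M. x \<in> ball x0 (d x0) \<longrightarrow> x \<in> R \<longrightarrow> Q x)"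
    using bchoice[of R "\<lambda>x0 d. d > 0 \<and> (AE x in M. x \<in> ball x0 d \<longrightarrow> x \<in> R \<longrightarrow> Q x)"] assms by auto
  define \<F> where "\<F> = (\<lambda>x0. ball x0 (d x0)) ` R"
  have "open S" if "S \<in> \<F>" for S
    using that by (auto simp: \<F>_def)
  then obtain \<F>' where F: "\<F>' \<subseteq> \<F>" "countable \<F>'" "\<Union>\<F>' = \<Union>\<F>"
    by (rule Lindelof)
  have "AE x in M. \<forall>S\<in>\<F>'. x \<in> S \<longrightarrow> x \<in> R \<longrightarrow> Q x"
    unfolding AE_ball_countable[OF F(2)] using F(1) d by (auto simp: \<F>_def)
  then show ?thesis
  proof eventually_elim
    case (elim x)
    have "x \<in> \<Union>\<F>" if "x \<in> R"
      unfolding \<F>_def using d that by (auto intro!: bexI[of _ x])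
    then show ?case
      using elim F(3) by blast
  qed
qed

text \<open>Compactness of the unit ball and scaling: the same finite \<open>K\<close> serves all
  centres and radii.\<close>

lemma ball_finite_cover:
  "\<exists>K :: 'a::euclidean_space set. finite K \<and>
    (\<forall>z r. r > 0 \<longrightarrow> ball z r \<subseteq> (\<Union>k\<in>K. ball (z + r *\<^sub>R k) (r / 2)))"
proof -
  have "compact (cball (0::'a) 1)" by simp
  then obtain K where K: "finite K" "cball (0::'a) 1 \<subseteq> (\<Union>k\<in>K. ball k (1 / 2))"
    unfolding compact_eq_totally_bounded by (meson half_gt_zero zero_less_one)
  have "ball z r \<subseteq> (\<Union>k\<in>K. ball (z + r *\<^sub>R k) (r / 2))" if r: "r > 0" for z r
  proof
    fix y assume "y \<in> ball z r"
    then have "norm (y - z) < r"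
      by (simp add: dist_norm norm_minus_commute)
    then have "(1 / r) *\<^sub>R (y - z) \<in> cball 0 1"
      using r by simp
    then obtain k where k: "k \<in> K" "norm (k - (1 / r) *\<^sub>R (y - z)) < 1 / 2"
      using subsetD[OF K(2)] unfolding dist_norm ball_def by blast
    have "z + r *\<^sub>R k - y = r *\<^sub>R (k - (1 / r) *\<^sub>R (y - z))"
      using r by (simp add: algebra_simps)
    then have "dist (z + r *\<^sub>R k) y = r * norm (k - (1 / r) *\<^sub>R (y - z))"
      using r by (simp add: dist_norm)
    also have "\<dots> < r * (1 / 2)"
      using k(2) r by (intro mult_strict_left_mono) auto
    finally show "y \<in> (\<Union>k\<in>K. ball (z + r *\<^sub>R k) (r / 2))"
      using k(1) by auto
  qed
  with K(1) show ?thesis by blast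
qed

lemma ennreal_inverse_antimono: "a \<le> b \<Longrightarrow> inverse b \<le> inverse (a :: ennreal)"
  by (simp add: less_eq_ennreal.rep_eq inverse_ennreal.rep_eq ereal_inverse_antimono)

text \<open>\<open>E\<close> lies in every ball of radius \<open>r\<close> about one of its points,
  so on \<open>E\<close> the integrand is at most the inverse of the mass of
  \<open>E\<close>.\<close>

lemma nn_integral_inverse_ball_bound:
  fixes M :: "'a::euclidean_space measure"
  assumes "finite_measure M" and [measurable_cong]: "sets M = sets borel"
    and g[measurable]: "(\<lambda>y. inverse (emeasure M (ball y r))) \<in> borel_measurable borel"
    and "E \<in> sets borel" and diam: "\<And>y y'. y \<in> E \<Longrightarrow> y' \<in> E \<Longrightarrow> dist y y' < r"
  shows "(\<integral>\<^sup>+ y. indicator E y * inverse (emeasure M (ball y r)) \<partial>M) \<le> 1"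
proof -
  interpret finite_measure M by fact
  have [measurable]: "E \<in> sets M" using assms(2,4) by simp
  have "(\<integral>\<^sup>+ y. indicator E y * inverse (emeasure M (ball y r)) \<partial>M)
      \<le> (\<integral>\<^sup>+ y. inverse (emeasure M E) * indicator E y \<partial>M)"
  proof (rule nn_integral_mono)
    fix y
    have "emeasure M E \<le> emeasure M (ball y r)" if "y \<in> E"
      using diam[OF that] assms(2) by (intro emeasure_mono) auto
    then show "indicator E y * inverse (emeasure M (ball y r)) \<le> inverse (emeasure M E) * indicator E y"
      by (auto simp: indicator_def intro: ennreal_inverse_antimono)
  qed
  also have "\<dots> = inverse (emeasure M E) * emeasure M E"
    by (simp add: nn_integral_cmult)
  also have "\<dots> \<le> 1"
  \<comment> \<open>If \<open>E\<close> has mass 0, the inverse is infinite, but its product with 0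
    is 0 in \<open>ennreal\<close>.\<close>
  proof (cases "emeasure M E = 0")
    case False
    moreover have "emeasure M E < \<top>"
      by (simp flip: less_top)
    moreover have "inverse (emeasure M E) * emeasure M E = emeasure M E / emeasure M E"
      by (simp add: divide_ennreal_def mult.commute)
    ultimately show ?thesis
      by (simp add: ennreal_divide_self)
  qed simp
  finally show ?thesis .
qed

text \<open>Markov's inequality for \<open>N (ball y r) / M (ball y r)\<close>, whose \<open>M\<close>-integral is, by Tonelli,
  the \<open>N\<close>-integral of a bounded function.\<close>

lemma finite_measure_ball_ratio:
  fixes M N :: "'a::euclidean_space measure" and K :: "'a set"
  assumes "finite K" and K: "\<forall>z r. r > 0 \<longrightarrow> ball z r \<subseteq> (\<Union>k\<in>K. ball (z + r *\<^sub>R k) (r / 2))"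
    and M: "finite_measure M" and N: "finite_measure N"
    and sM[measurable_cong]: "sets M = sets borel" and sN[measurable_cong]: "sets N = sets borel"
    and r: "r > 0" and t: "t \<ge> 0"
  shows "{y. t * measure M (ball y r) < measure N (ball y r)} \<in> sets borel"
    and "t * measure M {y. t * measure M (ball y r) < measure N (ball y r)} \<le> card K * measure N UNIV"
proof -
  interpret M: finite_measure M by fact
  interpret N: finite_measure N by fact
  interpret pair_sigma_finite N M ..
  have spM: "space M = UNIV" "space N = UNIV"
    using sets_eq_imp_space_eq[OF sM] sets_eq_imp_space_eq[OF sN] by auto
  have Q: "{p::'a \<times> 'a. dist (fst p) (snd p) < r} \<in> sets (borel \<Otimes>\<^sub>M borel)"
    unfolding borel_prod by (intro borel_open open_Collect_less continuous_intros)
  have Pair: "Pair y -` {p. dist (fst p) (snd p) < r} = ball y r" for y :: 'a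
    by auto
  have mM[measurable]: "(\<lambda>y. emeasure M (ball y r)) \<in> borel_measurable borel"
    using M.measurable_emeasure_Pair[of "{p. dist (fst p) (snd p) < r}" borel] Q
    unfolding sets_pair_measure_cong[OF refl sM] Pair by simp
  have mN[measurable]: "(\<lambda>y. emeasure N (ball y r)) \<in> borel_measurable borel"
    using N.measurable_emeasure_Pair[of "{p. dist (fst p) (snd p) < r}" borel] Q
    unfolding sets_pair_measure_cong[OF refl sN] Pair by simp
  define S where "S = {y. t * measure M (ball y r) < measure N (ball y r)}"
  show S[measurable]: "S \<in> sets borel"
    unfolding S_def measure_def by measurable
  define g where "g y = inverse (emeasure M (ball y r))" for y
  have g[measurable]: "g \<in> borel_measurable borel"
    unfolding g_def by measurable
  have pw: "ennreal t * indicator S y \<le> emeasure N (ball y r) * g y" for y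
  proof (cases "y \<in> S")
    case True
    then have lt: "t * measure M (ball y r) < measure N (ball y r)" by (simp add: S_def)
    then have pos: "measure N (ball y r) > 0"
      using t by (smt (verit) measure_nonneg mult_nonneg_nonneg)
    show ?thesis
    \<comment> \<open>A ball of \<open>M\<close>-mass 0 makes \<open>g y\<close> infinite, and the
      strict inequality defining \<open>S\<close> gives that ball positive
      \<open>N\<close>-mass.\<close>
    proof (cases "measure M (ball y r) = 0")
      case True
      then have "g y = \<top>" by (simp add: g_def M.emeasure_eq_measure)
      then show ?thesis
        using pos by (simp add: N.emeasure_eq_measure ennreal_mult_top)
    next
      case False
      then have pM: "measure M (ball y r) > 0" by (simp add: zero_less_measure_iff)
      then have "t \<le> measure N (ball y r) * inverse (measure M (ball y r))"
        using lt by (simp add: field_simps)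
      then have "ennreal t \<le> ennreal (measure N (ball y r)) * ennreal (inverse (measure M (ball y r)))"
        by (metis ennreal_leI ennreal_mult' measure_nonneg)
      also have "\<dots> = emeasure N (ball y r) * g y"
        using pM by (simp add: g_def M.emeasure_eq_measure N.emeasure_eq_measure inverse_ennreal)
      finally show ?thesis by (simp add: True)
    qed
  qed simp
  have "ennreal t * emeasure M S = (\<integral>\<^sup>+ y. ennreal t * indicator S y \<partial>M)"
    by (simp add: nn_integral_cmult_indicator)
  also have "\<dots> \<le> (\<integral>\<^sup>+ y. emeasure N (ball y r) * g y \<partial>M)"
    by (intro nn_integral_mono pw)
  also have "\<dots> = (\<integral>\<^sup>+ y. (\<integral>\<^sup>+ z. indicator (ball y r) z * g y \<partial>N) \<partial>M)"
    by (intro nn_integral_cong, subst nn_integral_multc) (simp_all add: sN borel_measurable_indicator)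
  also have "\<dots> = (\<integral>\<^sup>+ y. (\<integral>\<^sup>+ z. indicator {p. dist (fst p) (snd p) < r} (y, z) * g y \<partial>N) \<partial>M)"
    by (intro nn_integral_cong) (auto simp: indicator_def)
  also have "\<dots> = (\<integral>\<^sup>+ z. (\<integral>\<^sup>+ y. indicator {p. dist (fst p) (snd p) < r} (y, z) * g y \<partial>M) \<partial>N)"
  proof (rule Fubini')
    have "(\<lambda>(z, y). indicator {p. dist (fst p) (snd p) < r} (y, z) * g y)
        \<in> borel_measurable (borel \<Otimes>\<^sub>M borel)"
      using Q by measurable
    then show "(\<lambda>(z, y). indicator {p. dist (fst p) (snd p) < r} (y, z) * g y) \<in> borel_measurable (N \<Otimes>\<^sub>M M)"
      by (simp cong: measurable_cong_sets add: sets_pair_measure_cong[OF sN sM])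
  qed
  \<comment> \<open>Two points of a half-radius ball are less than \<open>r\<close> apart, so each
    of the \<open>card K\<close> balls contributes at most 1 to the inner integral.\<close>
  also have "\<dots> \<le> (\<integral>\<^sup>+ z. ennreal (card K) \<partial>N)"
  proof (rule nn_integral_mono)
    fix z
    have "(\<integral>\<^sup>+ y. indicator {p. dist (fst p) (snd p) < r} (y, z) * g y \<partial>M)
        \<le> (\<integral>\<^sup>+ y. (\<Sum>k\<in>K. indicator (ball (z + r *\<^sub>R k) (r / 2)) y * g y) \<partial>M)"
    proof (rule nn_integral_mono)
      fix y
      show "indicator {p. dist (fst p) (snd p) < r} (y, z) * g y
          \<le> (\<Sum>k\<in>K. indicator (ball (z + r *\<^sub>R k) (r / 2)) y * g y)"
      proof (cases "dist y z < r")
        case True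
        then have "y \<in> ball z r" by (simp add: dist_commute)
        then obtain k where k: "k \<in> K" "y \<in> ball (z + r *\<^sub>R k) (r / 2)"
          using K[rule_format, OF r, of z] by blast
        have "g y = indicator (ball (z + r *\<^sub>R k) (r / 2)) y * g y"
          using k(2) by simp
        also have "\<dots> \<le> (\<Sum>k\<in>K. indicator (ball (z + r *\<^sub>R k) (r / 2)) y * g y)"
          using member_le_sum[OF k(1), of "\<lambda>k. indicator (ball (z + r *\<^sub>R k) (r / 2)) y * g y"] assms(1) by simp
        finally show ?thesis by (simp add: True)
      qed simp
    qed
    also have "\<dots> = (\<Sum>k\<in>K. (\<integral>\<^sup>+ y. indicator (ball (z + r *\<^sub>R k) (r / 2)) y * g y \<partial>M))"
    proof (rule nn_integral_sum)
      fix k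
      have "(\<lambda>y. indicator (ball (z + r *\<^sub>R k) (r / 2)) y * g y) \<in> borel_measurable borel"
        by (intro borel_measurable_times_ennreal borel_measurable_indicator g) simp
      then show "(\<lambda>y. indicator (ball (z + r *\<^sub>R k) (r / 2)) y * g y) \<in> borel_measurable M"
        by (simp cong: measurable_cong_sets add: sM)
    qed
    also have "\<dots> \<le> (\<Sum>k\<in>K. 1)"
    proof (rule sum_mono)
      fix k
      show "(\<integral>\<^sup>+ y. indicator (ball (z + r *\<^sub>R k) (r / 2)) y * g y \<partial>M) \<le> 1"
        unfolding g_def
      proof (rule nn_integral_inverse_ball_bound[OF M sM])
        show "(\<lambda>y. inverse (emeasure M (ball y r))) \<in> borel_measurable borel"
          by measurable
        fix y y' assume "y \<in> ball (z + r *\<^sub>R k) (r / 2)" "y' \<in> ball (z + r *\<^sub>R k) (r / 2)"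
        then show "dist y y' < r"
          using dist_triangle_half_r[of "z + r *\<^sub>R k" y r y'] by simp
      qed simp
    qed
    finally show "(\<integral>\<^sup>+ y. indicator {p. dist (fst p) (snd p) < r} (y, z) * g y \<partial>M) \<le> ennreal (card K)"
      by (simp add: ennreal_of_nat_eq_real_of_nat)
  qed
  also have "\<dots> = ennreal (card K * measure N UNIV)"
    by (simp add: spM N.emeasure_eq_measure ennreal_mult)
  finally have "ennreal (t * measure M S) \<le> ennreal (card K * measure N UNIV)"
    using t by (simp add: M.emeasure_eq_measure ennreal_mult)
  then show "t * measure M S \<le> card K * measure N UNIV"
    by simp
qed

text \<open>The ratio bound with threshold \<open>2 powr (\<delta> * real n)\<close> makes the
  exceptional sets geometrically small, and Borel-Cantelli applies.\<close>

lemma AE_ball_comparison: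
  fixes M N :: "'a::euclidean_space measure"
  assumes M: "finite_measure M" and N: "finite_measure N"
    and sM: "sets M = sets borel" and sN: "sets N = sets borel" and "\<delta> > 0"
  shows "AE y in M. \<forall>\<^sub>F n in sequentially.
    measure N (ball y (1 / 2 ^ n)) \<le> 2 powr (\<delta> * real n) * measure M (ball y (1 / 2 ^ n))"
proof -
  interpret M: finite_measure M by fact
  obtain K :: "'a set" where "finite K \<and>
      (\<forall>z r. r > 0 \<longrightarrow> ball z r \<subseteq> (\<Union>k\<in>K. ball (z + r *\<^sub>R k) (r / 2)))"
    using ball_finite_cover ..
  note K = conjunct1[OF this] conjunct2[OF this]
  define S where "S n = {y. 2 powr (\<delta> * real n) * measure M (ball y (1 / 2 ^ n)) < measure N (ball y (1 / 2 ^ n))}" for n :: nat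
  have r: "1 / 2 ^ n > (0::real)" for n by simp
  have S: "S n \<in> sets M" for n
    unfolding S_def sM by (rule finite_measure_ball_ratio(1)[OF K M N sM sN r powr_ge_zero])
  have bound: "measure M (S n) \<le> card K * measure N UNIV * (2 powr (- \<delta>)) ^ n" for n
  proof -
    have "2 powr (\<delta> * real n) * measure M (S n) \<le> card K * measure N UNIV"
      unfolding S_def by (rule finite_measure_ball_ratio(2)[OF K M N sM sN r powr_ge_zero])
    moreover have "(2 powr (- \<delta>)) ^ n * 2 powr (\<delta> * real n) = 1"
    proof -
      have "(2 powr (- \<delta>)) ^ n = 2 powr (- \<delta> * real n)"
        using powr_realpow[of "2 powr (- \<delta>)" n] by (simp add: powr_powr)
      then show ?thesis
        by (simp add: powr_add[symmetric])
    qed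
    moreover have "x \<le> c * p" if "q * x \<le> c" "p * q = 1" "p \<ge> 0" for x c p q :: real
    proof -
      have "p * (q * x) \<le> p * c"
        using that by (intro mult_left_mono)
      then show ?thesis
        using that(2) by (simp add: mult.assoc[symmetric] mult.commute[of c p])
    qed
    ultimately show ?thesis
      by simp
  qed
  have "AE y in M. \<forall>\<^sub>F n in sequentially. y \<in> space M - S n"
  proof (rule borel_cantelli_AE1[OF S])
    show "emeasure M (S n) < \<infinity>" for n
      by (simp flip: less_top)
    have "2 powr (- \<delta>) < 1"
      using \<open>\<delta> > 0\<close> by (simp add: powr_less_one)
    then show "summable (\<lambda>n. measure M (S n))"
      using bound by (intro summable_comparison_test'[OF summable_mult[OF summable_geometric]]) auto
  qed
  then show ?thesis
    by eventually_elim (auto simp: S_def not_less elim: eventually_mono)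
qed

subsection \<open>Upper bounds for the mass of balls\<close>

context straightening_chart
begin

lemma bounded_P:
  obtains R where "R \<ge> 0" "\<And>x. x \<in> ball x0 d \<Longrightarrow> norm (P x) \<le> R"
proof -
  obtain K where K: "K > 0" "\<And>x. norm (P x) \<le> K * norm x"
    using linear_bounded_pos[OF linear_P] by metis
  have "norm (P x) \<le> K * (norm x0 + \<bar>d\<bar>)" if "x \<in> ball x0 d" for x
  proof -
    have "norm (x0 - x) < d" using that by (simp add: dist_norm)
    then have "norm x \<le> norm x0 + \<bar>d\<bar>"
      using norm_triangle_ineq2[of x x0] by (simp add: norm_minus_commute)
    then show ?thesis
      using K(1) K(2)[of x] by (smt (verit) mult_left_mono)
  qed
  moreover have "K * (norm x0 + \<bar>d\<bar>) \<ge> 0" using K(1) by simp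
  ultimately show thesis using that by blast
qed

lemma dist_le_G:
  assumes "\<And>z w. z \<in> ball x0 d \<Longrightarrow> norm (B z w - w) \<le> norm w / 2"
    and "x \<in> ball x0 d" "x' \<in> ball x0 d"
  shows "norm (x - x') \<le> 2 * norm (G x - G x')" and "norm (G x - G x') \<le> 2 * norm (x - x')"
  using G_bilipschitz[OF assms] norm_triangle_ineq2[of "x - x'" "G x - G x'"]
    norm_triangle_ineq2[of "G x - G x'" "x - x'"]
  by (simp_all add: norm_minus_commute)

text \<open>A fibre of \<open>f\<close> thickened by \<open>r\<close> is parametrised by \<open>P\<close> up to an error of order \<open>r\<close>,
  so it is covered by \<open>r ^ (- dim ker)\<close> many balls of radius proportional to \<open>r\<close>.\<close>

lemma emeasure_preimage_ball:
  "\<exists>d>0. \<exists>C\<ge>0. \<forall>y r. 0 < r \<and> r \<le> 1 \<longrightarrow>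
     emeasure lborel (ball x0 d \<inter> f -` ball y r) \<le> ennreal (C * r ^ differential_rank f x0)"
proof -
  obtain d where d: "d > 0" and Bd: "\<And>z w. z \<in> ball x0 d \<Longrightarrow> norm (B z w - w) \<le> norm w / 2"
    using B_near_id by blast
  obtain R where R: "R \<ge> 0" "\<And>x. x \<in> ball x0 d \<Longrightarrow> norm (P x) \<le> R"
    using bounded_P by blast
  obtain M where M: "M > 0" "\<And>y. norm (L y) \<le> M * norm y"
    using linear_bounded_pos[OF linear_L] by metis
  obtain K where K: "K \<ge> 0" "\<And>s. 0 < s \<Longrightarrow> s \<le> 1 \<Longrightarrow>
    \<exists>q :: 'a \<Rightarrow> 'a \<Rightarrow> int. finite (q ` (ker \<inter> cball 0 R)) \<and>
      real (card (q ` (ker \<inter> cball 0 R))) \<le> K * (1 / s) ^ dim ker \<and>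
      (\<forall>u\<in>ker. \<forall>v\<in>ker. q u = q v \<longrightarrow> norm (u - v) \<le> s)"
    using subspace_quantization[OF subspace_ker R(1)] by metis
  \<comment> \<open>The outer 2 is the Lipschitz constant of the inverse of \<open>G\<close>;
    \<open>2 * M\<close> comes from \<open>L\<close> applied to the difference of two points in a
    ball of radius \<open>r\<close>, and 1 from the grid for \<open>P\<close>.\<close>
  define \<rho> where "\<rho> = 2 * (2 * M + 1)"
  define V where "V = unit_ball_vol (real DIM('a))"
  have V: "V \<ge> 0" by (simp add: V_def)
  have \<rho>: "\<rho> > 0" using M(1) by (simp add: \<rho>_def)
  have main: "emeasure lborel (ball x0 d \<inter> f -` ball y r)
      \<le> ennreal (K * V * \<rho> ^ DIM('a) * r ^ differential_rank f x0)" if r: "0 < r" "r \<le> 1" for y r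
  proof -
    obtain q :: "'a \<Rightarrow> 'a \<Rightarrow> int" where q: "finite (q ` (ker \<inter> cball 0 R))"
      "real (card (q ` (ker \<inter> cball 0 R))) \<le> K * (1 / r) ^ dim ker"
      "\<And>u v. u \<in> ker \<Longrightarrow> v \<in> ker \<Longrightarrow> q u = q v \<Longrightarrow> norm (u - v) \<le> r"
      using K(2)[OF r] by metis
    define S where "S = ball x0 d \<inter> f -` ball y r"
    define F where "F = (\<lambda>x. q (P x)) ` S"
    have FS: "F \<subseteq> q ` (ker \<inter> cball 0 R)"
      using R(2) P_in_ker by (auto simp: F_def S_def)
    have finF: "finite F" using FS q(1) finite_subset by blast
    have cardF: "real (card F) \<le> K * (1 / r) ^ dim ker"
      using card_mono[OF q(1) FS] q(2) by linarith
    define c where "c i = (SOME x. x \<in> S \<and> q (P x) = i)" for i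
    have c: "c i \<in> S \<and> q (P (c i)) = i" if "i \<in> F" for i
      unfolding c_def by (rule someI_ex) (use that in \<open>auto simp: F_def\<close>)
    have sub: "S \<subseteq> (\<Union>i\<in>F. cball (c i) (\<rho> * r))"
    proof
      fix x assume x: "x \<in> S"
      let ?c = "c (q (P x))"
      have i: "q (P x) \<in> F" using x by (simp add: F_def)
      have cS: "?c \<in> S" and qc: "q (P ?c) = q (P x)" using c[OF i] by auto
      have "norm (f x - f ?c) \<le> norm (f x - y) + norm (f ?c - y)"
        using norm_triangle_ineq4[of "f x - y" "f ?c - y"] by simp
      also have "\<dots> \<le> r + r"
        using x cS by (intro add_mono) (auto simp: S_def dist_norm norm_minus_commute less_imp_le)
      finally have "norm (L (f x - f ?c)) \<le> M * (2 * r)"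
        using M(1) M(2)[of "f x - f ?c"] by (smt (verit) mult_left_mono)
      moreover have "norm (P x - P ?c) \<le> r"
        using q(3)[OF P_in_ker P_in_ker qc] by (simp add: norm_minus_commute)
      moreover have "G x - G ?c = L (f x - f ?c) + (P x - P ?c)"
        unfolding G_def linear_diff[OF linear_L] by simp
      moreover have "(2 * M + 1) * r = M * (2 * r) + r"
        by (simp add: algebra_simps)
      ultimately have "norm (G x - G ?c) \<le> (2 * M + 1) * r"
        using norm_triangle_ineq[of "L (f x - f ?c)" "P x - P ?c"] by simp
      then have "norm (x - ?c) \<le> \<rho> * r"
        using dist_le_G(1)[where d = d and x = x and x' = ?c, OF Bd] x cS
        by (simp add: S_def \<rho>_def algebra_simps)
      then show "x \<in> (\<Union>i\<in>F. cball (c i) (\<rho> * r))"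
        using i by (auto intro!: bexI[of _ "q (P x)"] simp: dist_norm norm_minus_commute)
    qed
    have "emeasure lborel S \<le> emeasure lborel (\<Union>i\<in>F. cball (c i) (\<rho> * r))"
      using sub finF by (intro emeasure_mono) auto
    also have "\<dots> \<le> (\<Sum>i\<in>F. emeasure lborel (cball (c i) (\<rho> * r)))"
      using finF by (intro emeasure_subadditive_finite) auto
    also have "\<dots> = ennreal (card F * (V * (\<rho> * r) ^ DIM('a)))"
      using r \<rho> V by (simp add: emeasure_cball V_def ennreal_mult ennreal_of_nat_eq_real_of_nat)
    also have "\<dots> \<le> ennreal (K * V * \<rho> ^ DIM('a) * r ^ differential_rank f x0)"
    proof (rule ennreal_leI)
      have "card F * (V * (\<rho> * r) ^ DIM('a)) \<le> (K * (1 / r) ^ dim ker) * (V * (\<rho> * r) ^ DIM('a))"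
        using cardF V \<rho> r by (intro mult_right_mono) auto
      \<comment> \<open>Rank-nullity: \<open>dim ker\<close> powers of \<open>r\<close> pay for the
        number of balls, and as many as the rank remain.\<close>
      also have "\<dots> = K * V * \<rho> ^ DIM('a) * ((1 / r) ^ dim ker * r ^ (dim ker + differential_rank f x0))"
        by (simp only: dim_ker) (simp add: power_mult_distrib)
      also have "(1 / r) ^ dim ker * r ^ (dim ker + differential_rank f x0) = r ^ differential_rank f x0"
        using r by (simp add: power_add power_divide)
      finally show "card F * (V * (\<rho> * r) ^ DIM('a)) \<le> K * V * \<rho> ^ DIM('a) * r ^ differential_rank f x0" .
    qed
    finally show ?thesis by (simp add: S_def)
  qed
  have "K * V * \<rho> ^ DIM('a) \<ge> 0" using K(1) V \<rho> by simp
  with d main show ?thesis by blast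
qed

end

text \<open>\<open>N\<close> is compared with the image \<open>M\<close> of Lebesgue measure on a
  chart ball: \<open>M\<close> gives balls mass \<open>O(r ^ k)\<close>, and the comparison costs
  \<open>r powr (- \<delta>)\<close>. An \<open>M\<close>-null set of values pulls back to a
  Lebesgue-null set within the chart ball.\<close>

lemma AE_mass_upper_bound:
  fixes f :: "'a::euclidean_space \<Rightarrow> 'b::euclidean_space"
  assumes f: "C_infinity f" and N: "finite_measure N" "sets N = sets borel" and \<delta>: "\<delta> > 0"
  shows "AE x in lborel. \<exists>C. \<forall>\<^sub>F n in sequentially.
    measure N (ball (f x) (1 / 2 ^ n)) \<le> C * (1 / 2 ^ n) powr (real (differential_rank f x) - \<delta>)"
    (is "AE x in lborel. ?Q x")
proof -
  have [measurable]: "f \<in> borel_measurable borel"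
    by (intro borel_measurable_continuous_onI C_infinity_continuous f)
  have local: "\<exists>d>0. AE x in lborel. x \<in> ball x0 d \<longrightarrow> (differential_rank f x = differential_rank f x0 \<longrightarrow> ?Q x)" for x0
  proof -
    obtain L where "straightening_chart f x0 L"
      using straightening_chart_exists[OF f] by blast
    then interpret straightening_chart f x0 L .
    obtain d C where d: "d > 0" and C: "C \<ge> 0" and bd: "\<And>y r. 0 < r \<Longrightarrow> r \<le> 1 \<Longrightarrow>
       emeasure lborel (ball x0 d \<inter> f -` ball y r) \<le> ennreal (C * r ^ differential_rank f x0)"
      using emeasure_preimage_ball by metis
    \<comment> \<open>Restriction by a density keeps the whole space as carrier, and
      \<open>AE_density\<close> later returns to \<open>lborel\<close>.\<close>
    define M0 where "M0 = density lborel (indicator (ball x0 d))"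
    define M where "M = distr M0 borel f"
    have [measurable]: "f \<in> borel_measurable M0" by (simp add: M0_def)
    have emM: "emeasure M X = emeasure lborel (ball x0 d \<inter> f -` X)" if [measurable]: "X \<in> sets borel" for X
    proof -
      have fX: "f -` X \<in> sets borel"
        using measurable_sets[of f borel borel X] by simp
      have "emeasure M X = emeasure M0 (f -` X)"
        by (simp add: M_def emeasure_distr M0_def)
      also have "\<dots> = (\<integral>\<^sup>+ x. indicator (ball x0 d) x * indicator (f -` X) x \<partial>lborel)"
        unfolding M0_def by (rule emeasure_density) (use fX in \<open>auto intro: borel_measurable_indicator\<close>)
      also have "\<dots> = (\<integral>\<^sup>+ x. indicator (ball x0 d \<inter> f -` X) x \<partial>lborel)"
        by (simp add: indicator_inter_arith)
      also have "\<dots> = emeasure lborel (ball x0 d \<inter> f -` X)"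
        by (rule nn_integral_indicator) (use fX in auto)
      finally show ?thesis .
    qed
    have finM: "finite_measure M"
    proof
      have "emeasure M (space M) \<le> emeasure lborel (ball x0 d)"
        by (subst emM) (auto simp: M_def intro: emeasure_mono)
      also have "\<dots> < \<infinity>"
        by (rule emeasure_lborel_ball_finite)
      finally show "emeasure M (space M) \<noteq> \<infinity>" by simp
    qed
    have sM: "sets M = sets borel" by (simp add: M_def)
    have "AE y in M. \<forall>\<^sub>F n in sequentially.
        measure N (ball y (1 / 2 ^ n)) \<le> 2 powr (\<delta> * real n) * measure M (ball y (1 / 2 ^ n))"
      by (rule AE_ball_comparison[OF finM N(1) sM N(2) \<delta>])
    then have "AE x in M0. \<forall>\<^sub>F n in sequentially.
        measure N (ball (f x) (1 / 2 ^ n)) \<le> 2 powr (\<delta> * real n) * measure M (ball (f x) (1 / 2 ^ n))"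
      unfolding M_def by (rule AE_distrD[rotated]) simp
    then have "AE x in lborel. x \<in> ball x0 d \<longrightarrow> (\<forall>\<^sub>F n in sequentially.
        measure N (ball (f x) (1 / 2 ^ n)) \<le> 2 powr (\<delta> * real n) * measure M (ball (f x) (1 / 2 ^ n)))"
      unfolding M0_def by (subst (asm) AE_density)
        (auto simp: indicator_def intro!: borel_measurable_indicator split: if_splits)
    then have "AE x in lborel. x \<in> ball x0 d \<longrightarrow> (differential_rank f x = differential_rank f x0 \<longrightarrow> ?Q x)"
    proof eventually_elim
      case (elim x)
      show ?case
      proof (intro impI)
        assume "x \<in> ball x0 d" and rank: "differential_rank f x = differential_rank f x0"
        with elim have "\<forall>\<^sub>F n in sequentially.
          measure N (ball (f x) (1 / 2 ^ n)) \<le> 2 powr (\<delta> * real n) * measure M (ball (f x) (1 / 2 ^ n))"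
          by blast
        then have "\<forall>\<^sub>F n in sequentially.
          measure N (ball (f x) (1 / 2 ^ n)) \<le> C * (1 / 2 ^ n) powr (real (differential_rank f x) - \<delta>)"
        proof eventually_elim
          case (elim n)
          let ?r = "1 / 2 ^ n :: real"
          have "ennreal (measure M (ball (f x) ?r)) \<le> ennreal (C * ?r ^ differential_rank f x0)"
            using bd[of ?r "f x"] emM[of "ball (f x) ?r"] finite_measure.emeasure_eq_measure[OF finM]
            by simp
          then have "measure M (ball (f x) ?r) \<le> C * ?r ^ differential_rank f x0"
            using C by simp
          then have "2 powr (\<delta> * real n) * measure M (ball (f x) ?r)
              \<le> 2 powr (\<delta> * real n) * (C * ?r ^ differential_rank f x0)"
            by (intro mult_left_mono) auto
          also have "\<dots> = C * ?r powr (real (differential_rank f x) - \<delta>)"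
          proof -
            have r: "?r = 2 powr (- real n)"
              by (simp add: powr_minus powr_realpow divide_inverse)
            have "?r powr (real (differential_rank f x) - \<delta>) = ?r powr real (differential_rank f x0) * ?r powr (- \<delta>)"
              by (simp add: rank flip: powr_add)
            also have "?r powr real (differential_rank f x0) = ?r ^ differential_rank f x0"
              by (rule powr_realpow) simp
            also have "?r powr (- \<delta>) = 2 powr (\<delta> * real n)"
              unfolding r by (simp add: powr_powr mult.commute)
            finally show ?thesis by simp
          qed
          finally show ?case using elim by linarith
        qed
        then show "?Q x" by blast
      qed
    qed
    with d show ?thesis by blast
  qed
  \<comment> \<open>The rank takes countably many values, so the local statements can be glued for
    each \<open>k\<close> separately.\<close>
  have "AE x in lborel. x \<in> {x. differential_rank f x = k} \<longrightarrow> ?Q x" for k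
  proof (rule AE_from_local)
    fix x0 assume "x0 \<in> {x. differential_rank f x = k}"
    then show "\<exists>d>0. AE x in lborel. x \<in> ball x0 d \<longrightarrow> x \<in> {x. differential_rank f x = k} \<longrightarrow> ?Q x"
      using local[of x0] by simp
  qed
  then have "AE x in lborel. \<forall>k. x \<in> {x. differential_rank f x = k} \<longrightarrow> ?Q x"
    by (subst AE_all_countable) blast
  then show ?thesis by simp
qed

subsection \<open>Increments near points of constant rank\<close>

text \<open>Coordinates are fixed from here on because determinants and Cramer's rule refer to
  matrices.\<close>

locale straightening_chart_cart = straightening_chart f x0 L
  for f :: "real ^ 'm \<Rightarrow> 'b::euclidean_space" and x0 L
begin

definition D :: "real ^ 'm \<Rightarrow> real" where "D z = det (matrix (B z))"

text \<open>By Cramer's rule this is \<open>D z *\<^sub>R w\<close> for the preimage \<open>w\<close> of \<open>v\<close> under \<open>B z\<close>, but it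
  is polynomial in the entries of \<open>B z\<close> and hence smooth on the whole space.\<close>

definition cramer_vec :: "real ^ 'm \<Rightarrow> real ^ 'm \<Rightarrow> real ^ 'm" where
  "cramer_vec v z = (\<chi> k. det (\<chi> i j. if j = k then v $ i else matrix (B z) $ i $ j))"

text \<open>Where \<open>B z\<close> is invertible, this is \<open>D z\<close> times the derivative
  of \<open>f\<close> in the direction that \<open>B z\<close> sends to \<open>v\<close>. For
  \<open>v\<close> in \<open>ker\<close> these are the smooth functions whose flatness is
  exploited.\<close>

definition \<omega> :: "real ^ 'm \<Rightarrow> real ^ 'm \<Rightarrow> 'b" where "\<omega> v z = A z (cramer_vec v z)"

lemma cramer_vec_B: "cramer_vec (B z w) z = D z *\<^sub>R w"
proof -
  have "B z w = matrix (B z) *v w"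
    using linear_B by simp
  then show ?thesis
    unfolding cramer_vec_def D_def by (simp only: cramer_lemma) (simp add: vec_eq_iff)
qed

lemma C_infinity_A: "C_infinity (\<lambda>z. A z w)"
  unfolding A_def by (rule C_infinity_frechet_derivative[OF smooth])

lemma C_infinity_B_entry: "C_infinity (\<lambda>z. matrix (B z) $ i $ j)"
proof -
  have "bounded_linear (\<lambda>y. L y $ i)"
    using bounded_linear_compose[OF bounded_linear_vec_nth linear_L[unfolded linear_conv_bounded_linear]]
    by simp
  then have "C_infinity (\<lambda>z. L (A z (axis j 1)) $ i + P (axis j 1) $ i)"
    by (intro C_infinity_add C_infinity_const C_infinity_bounded_linear[OF _ C_infinity_A])
  then show ?thesis
    by (simp add: matrix_def B_def)
qed

lemma C_infinity_D: "C_infinity D"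
  unfolding D_def[abs_def] by (intro C_infinity_det C_infinity_B_entry)

lemma C_infinity_\<omega>: "C_infinity (\<omega> v)"
proof -
  have entry: "C_infinity (\<lambda>z. cramer_vec v z $ k)" for k
  proof -
    have "C_infinity (\<lambda>z. (\<chi> i j. if j = k then v $ i else matrix (B z) $ i $ j) $ i $ j)" for i j
      by (cases "j = k") (simp_all add: C_infinity_const C_infinity_B_entry)
    then show ?thesis
      using C_infinity_det[of "\<lambda>z. (\<chi> i j. if j = k then v $ i else matrix (B z) $ i $ j)"]
      by (simp add: cramer_vec_def)
  qed
  have "\<omega> v = (\<lambda>z. \<Sum>k\<in>UNIV. cramer_vec v z $ k *\<^sub>R A z (axis k 1))"
  proof
    fix z
    have "cramer_vec v z = (\<Sum>k\<in>UNIV. cramer_vec v z $ k *\<^sub>R axis k 1)"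
      using basis_expansion[of "cramer_vec v z"] by (simp add: scalar_mult_eq_scaleR)
    then have "\<omega> v z = A z (\<Sum>k\<in>UNIV. cramer_vec v z $ k *\<^sub>R axis k 1)"
      by (simp add: \<omega>_def)
    then show "\<omega> v z = (\<Sum>k\<in>UNIV. cramer_vec v z $ k *\<^sub>R A z (axis k 1))"
      by (simp add: linear_sum[OF linear_A] linear_cmul[OF linear_A])
  qed
  then show ?thesis
    using C_infinity_sum[of UNIV "\<lambda>k z. cramer_vec v z $ k *\<^sub>R A z (axis k 1)"]
      C_infinity_bounded_bilinear[OF bounded_bilinear_scaleR entry C_infinity_A] by simp
qed

lemma surj_B_near:
  assumes "\<And>w. norm (B z w - w) \<le> norm w / 2"
  shows "surj (B z)"
proof (rule linear_inj_imp_surj[OF linear_B])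
  show "inj (B z)"
    unfolding linear_injective_0[OF linear_B]
  proof (intro allI impI)
    fix w assume "B z w = 0"
    then show "w = 0" using assms[of w] by simp
  qed
qed

lemma \<omega>_eq_0:
  assumes "\<And>w. norm (B z w - w) \<le> norm w / 2"
    and "differential_rank f z \<le> differential_rank f x0" and "v \<in> ker"
  shows "\<omega> v z = 0"
proof -
  obtain w where w: "B z w = v"
    using surj_B_near[OF assms(1)] by (metis surjD)
  then have "A z w = 0"
    using derivative_vanishes_on_B_preimage_ker[OF assms(2) surj_B_near[OF assms(1)]] assms(3) by simp
  then show ?thesis
    using cramer_vec_B[of z w] by (simp add: \<omega>_def w linear_cmul[OF linear_A])
qed

text \<open>The vectors \<open>P b\<close> span \<open>ker\<close>, so this one function controls
  the differential along all chart directions in \<open>ker\<close>.\<close>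

definition \<Omega> :: "real ^ 'm \<Rightarrow> real" where "\<Omega> z = (\<Sum>b\<in>Basis. norm (\<omega> (P b) z))"

lemma D_near:
  obtains d where "d > 0" "\<And>z. z \<in> ball x0 d \<Longrightarrow> D z \<ge> 1 / 2"
proof -
  have "matrix (B x0) = mat 1"
    by (simp add: matrix_def mat_def B_x0 vec_eq_iff axis_def)
  then have D1: "D x0 = 1" by (simp add: D_def)
  have "isCont D x0"
    using C_infinity_continuous[OF C_infinity_D, of UNIV] by (simp add: continuous_on_eq_continuous_at)
  then obtain d where "d > 0" and d: "\<forall>z. dist z x0 < d \<longrightarrow> dist (D z) (D x0) < 1 / 2"
    unfolding continuous_at_eps_delta by (meson half_gt_zero_iff zero_less_one)
  have "D z \<ge> 1 / 2" if "z \<in> ball x0 d" for z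
  proof -
    have "\<bar>D z - D x0\<bar> < 1 / 2"
      using d[rule_format, of z] that by (simp add: dist_commute[of x0 z] flip: dist_real_def)
    then show ?thesis using D1 by linarith
  qed
  with \<open>d > 0\<close> show thesis by (rule that)
qed

lemma A_bounded_near:
  obtains K where "K > 0" "\<And>z w. z \<in> cball x0 d \<Longrightarrow> norm (A z w) \<le> K * norm w"
proof -
  have "continuous_on UNIV (\<lambda>z. Blinfun (A z))"
    using linear_A
    by (intro continuous_on_blinfun_componentwise)
       (simp add: bounded_linear_Blinfun_apply linear_conv_bounded_linear continuous_A)
  then have "compact ((\<lambda>z. Blinfun (A z)) ` cball x0 d)"
    by (intro compact_continuous_image) (auto intro: continuous_on_subset)
  then obtain K where K: "K > 0" "\<forall>X\<in>(\<lambda>z. Blinfun (A z)) ` cball x0 d. norm X \<le> K"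
    using compact_imp_bounded bounded_pos by blast
  have "norm (A z w) \<le> K * norm w" if "z \<in> cball x0 d" for z w
  proof -
    have "norm (A z w) \<le> norm (Blinfun (A z)) * norm w"
      using norm_blinfun[of "Blinfun (A z)" w] linear_A
      by (simp add: bounded_linear_Blinfun_apply linear_conv_bounded_linear)
    also have "\<dots> \<le> K * norm w"
      using K(2) that by (intro mult_right_mono) auto
    finally show ?thesis .
  qed
  with K(1) show thesis by (rule that)
qed

text \<open>Split \<open>B z w\<close> into its part outside \<open>ker\<close> and its projection
  by \<open>P\<close>, and pull both back by \<open>B z\<close>. The first preimage is bounded
  because \<open>B z\<close> is close to the identity; on the second, the differential is a
  combination of the \<open>\<omega> (P b) z\<close> divided by \<open>D z\<close>.\<close>

lemma derivative_estimate:
  assumes Bd: "\<And>w. norm (B z w - w) \<le> norm w / 2" and D: "D z \<ge> 1 / 2"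
    and K: "K \<ge> 1" "\<And>w. norm (A z w) \<le> K * norm w"
  shows "norm (A z w) \<le> 2 * K * (norm (B z w - P (B z w)) + \<Omega> z * norm (B z w))"
proof -
  define u where "u = B z w"
  have surj: "surj (B z)" by (rule surj_B_near[OF Bd])
  have "\<forall>b. \<exists>w'. B z w' = P b"
    using surj by (metis surjD)
  then obtain p where p: "\<And>b. B z (p b) = P b" by metis
  define w2 where "w2 = (\<Sum>b\<in>Basis. (u \<bullet> b) *\<^sub>R p b)"
  have "B z w2 = P (\<Sum>b\<in>Basis. (u \<bullet> b) *\<^sub>R b)"
    by (simp add: w2_def p linear_sum[OF linear_B] linear_cmul[OF linear_B]
        linear_sum[OF linear_P] linear_cmul[OF linear_P])
  then have Bw2: "B z w2 = P u" by (simp add: euclidean_representation)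
  have "norm (w - w2) \<le> norm (B z (w - w2)) + norm (w - w2) / 2"
    using Bd[of "w - w2"] norm_triangle_ineq2[of "w - w2" "B z (w - w2)"]
    by (simp add: norm_minus_commute)
  then have "norm (w - w2) \<le> 2 * norm (u - P u)"
    using Bw2 by (simp add: linear_diff[OF linear_B] u_def)
  then have "K * norm (w - w2) \<le> K * (2 * norm (u - P u))"
    using K(1) by (intro mult_left_mono) auto
  then have 1: "norm (A z (w - w2)) \<le> 2 * K * norm (u - P u)"
    using K(2)[of "w - w2"] by simp
  have "norm (A z w2) \<le> (\<Sum>b\<in>Basis. 2 * norm u * norm (\<omega> (P b) z))"
    unfolding w2_def linear_sum[OF linear_A] linear_cmul[OF linear_A]
  proof (rule sum_norm_le)
    fix b :: "real ^ 'm" assume b: "b \<in> Basis"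
    have "\<omega> (P b) z = D z *\<^sub>R A z (p b)"
      using cramer_vec_B[of z "p b"] by (simp add: \<omega>_def p linear_cmul[OF linear_A])
    then have "norm (\<omega> (P b) z) = D z * norm (A z (p b))"
      using D by simp
    then have "norm (A z (p b)) \<le> 2 * norm (\<omega> (P b) z)"
      using mult_right_mono[OF D, of "norm (A z (p b))"] by simp
    then have "\<bar>u \<bullet> b\<bar> * norm (A z (p b)) \<le> norm u * (2 * norm (\<omega> (P b) z))"
      using Basis_le_norm[OF b] by (intro mult_mono) auto
    then show "norm ((u \<bullet> b) *\<^sub>R A z (p b)) \<le> 2 * norm u * norm (\<omega> (P b) z)"
      by simp
  qed
  also have "\<dots> = 2 * (\<Omega> z * norm u)"
    by (simp add: \<Omega>_def sum_distrib_left sum_distrib_right mult_ac)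
  also have "\<dots> \<le> 2 * K * (\<Omega> z * norm u)"
  proof -
    have "\<Omega> z * norm u \<ge> 0" by (auto simp: \<Omega>_def intro!: mult_nonneg_nonneg sum_nonneg)
    from mult_right_mono[OF K(1) this] show ?thesis by simp
  qed
  finally have 2: "norm (A z w2) \<le> 2 * K * (\<Omega> z * norm u)" .
  have "A z w = A z (w - w2) + A z w2"
    by (simp add: linear_diff[OF linear_A])
  then have "norm (A z w) \<le> norm (A z (w - w2)) + norm (A z w2)"
    by (metis norm_triangle_ineq)
  then show ?thesis
    using 1 2 by (simp add: u_def distrib_left)
qed

text \<open>Integrate the differential along the preimage under \<open>G\<close> of the segment from \<open>G x\<close> to
  \<open>G x'\<close>, along which \<open>L \<circ> f\<close> is affine.\<close>

lemma increment_estimate: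
  "\<exists>d>0. \<exists>C>0. (\<forall>z w. z \<in> ball x0 d \<longrightarrow> norm (B z w - w) \<le> norm w / 2) \<and>
    (\<forall>x x' W. x \<in> ball x0 d \<longrightarrow> x' \<in> ball x0 d \<longrightarrow> W \<ge> 0 \<longrightarrow>
      (\<forall>z. norm (z - x) \<le> 4 * norm (x' - x) \<longrightarrow> \<Omega> z \<le> W) \<longrightarrow>
      norm (f x' - f x) \<le> C * (norm (L (f x') - L (f x)) + W * norm (x' - x)))"
proof -
  obtain d1 where d1: "d1 > 0" "\<And>z w. z \<in> ball x0 d1 \<Longrightarrow> norm (B z w - w) \<le> norm w / 2"
    using B_near_id by blast
  obtain d2 where d2: "d2 > 0" "\<And>z. z \<in> ball x0 d2 \<Longrightarrow> D z \<ge> 1 / 2"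
    using D_near by blast
  define d0 where "d0 = min d1 d2"
  have d0: "d0 > 0" using d1(1) d2(1) by (simp add: d0_def)
  obtain K0 where K0: "K0 > 0" "\<And>z w. z \<in> cball x0 d0 \<Longrightarrow> norm (A z w) \<le> K0 * norm w"
    using A_bounded_near by blast
  define K where "K = max 1 K0"
  have K: "K \<ge> 1" "norm (A z w) \<le> K * norm w" if "z \<in> ball x0 d0" for z w
  proof -
    have "K0 * norm w \<le> K * norm w" by (intro mult_right_mono) (auto simp: K_def)
    then show "norm (A z w) \<le> K * norm w"
      using K0(2)[of z w] that by simp
  qed (simp add: K_def)
  have G': "(G has_derivative blinfun_apply (BB z)) (at z)" for z
    unfolding BB_apply by (rule G_deriv)
  have inv: "id_blinfun o\<^sub>L BB x0 = id_blinfun"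
    by (rule blinfun_eqI) (simp add: BB_apply B_x0)
  obtain U V g g' where U: "open U" "U \<subseteq> ball x0 d0" "x0 \<in> U" and V: "open V" "G x0 \<in> V"
    and hom: "homeomorphism U V G g"
    and g': "\<And>y. y \<in> V \<Longrightarrow> (g has_derivative (g' y)) (at y)"
    and g'inv: "\<And>y. y \<in> V \<Longrightarrow> g' y = inv (blinfun_apply (BB (g y)))"
    and bij: "\<And>y. y \<in> V \<Longrightarrow> bij (blinfun_apply (BB (g y)))"
    using inverse_function_theorem[OF open_ball G' continuous_on_subset[OF continuous_BB subset_UNIV]
        centre_in_ball[THEN iffD2, OF d0] inv] by metis
  obtain e where e: "e > 0" "ball (G x0) e \<subseteq> V"
    using V open_contains_ball by blast
  have contG: "isCont G x0"
    using G_deriv has_derivative_continuous by blast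
  then obtain d3 where d3: "d3 > 0" "\<forall>x. dist x x0 < d3 \<longrightarrow> dist (G x) (G x0) < e"
    unfolding continuous_at_eps_delta using e(1) by meson
  obtain d4 where d4: "d4 > 0" "ball x0 d4 \<subseteq> U"
    using U open_contains_ball by blast
  \<comment> \<open>\<open>d3\<close> puts \<open>G x\<close> and \<open>G x'\<close> into a ball
    inside \<open>V\<close>, hence also the segment between them; \<open>d4\<close> puts the points
    themselves into \<open>U\<close>, where \<open>g\<close> inverts \<open>G\<close>.\<close>
  define d where "d = min d3 d4"
  have d: "d > 0" using d3(1) d4(1) by (simp add: d_def)
  have d0': "x \<in> ball x0 d0" if "x \<in> ball x0 d" for x
    using that subset_trans[OF d4(2) U(2)] by (force simp: d_def subset_iff)
  have Bd: "norm (B z w - w) \<le> norm w / 2" if "z \<in> ball x0 d0" for z w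
    using d1(2) that by (simp add: d0_def)
  have main: "norm (f x' - f x) \<le> 4 * K * (norm (L (f x') - L (f x)) + W * norm (x' - x))"
    if x: "x \<in> ball x0 d" "x' \<in> ball x0 d" and W: "W \<ge> 0"
      and \<Omega>W: "\<And>z. norm (z - x) \<le> 4 * norm (x' - x) \<Longrightarrow> \<Omega> z \<le> W" for x x' W
  proof -
    define u where "u = G x' - G x"
    define y where "y t = G x + t *\<^sub>R u" for t :: real
    have Gball: "G x \<in> ball (G x0) e" "G x' \<in> ball (G x0) e"
      using x d3(2) by (auto simp: d_def dist_commute)
    have yV: "y t \<in> V" if "0 \<le> t" "t \<le> 1" for t
    proof -
      have "(1 - t) *\<^sub>R G x + t *\<^sub>R G x' \<in> ball (G x0) e"
        using that Gball by (intro convexD_alt[OF convex_ball]) auto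
      then show ?thesis
        using e(2) by (auto simp: y_def u_def algebra_simps)
    qed
    have gU: "g (y t) \<in> U" "G (g (y t)) = y t" if "0 \<le> t" "t \<le> 1" for t
      using hom yV[OF that] unfolding homeomorphism_def by auto
    have gG: "g (G x) = x" "g (G x') = x'"
      using hom x d4(2) unfolding homeomorphism_def by (auto simp: d_def)
    have nu: "norm u \<le> 2 * norm (x' - x)"
      using dist_le_G(2)[OF Bd d0'[OF x(2)] d0'[OF x(1)]] by (simp add: u_def)
    have uPu: "u - P u = L (f x') - L (f x)"
    proof -
      have "P (P w) = P w" for w using P_ker[OF P_in_ker] .
      then show ?thesis
        by (simp add: u_def G_def linear_diff[OF linear_P] linear_add[OF linear_P] P_L)
    qed
    have deriv: "((\<lambda>t. f (g (y t))) has_derivative (\<lambda>h. h *\<^sub>R A (g (y t)) (g' (y t) u))) (at t within {0..1})"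
      if t: "0 \<le> t" "t \<le> 1" for t
    proof -
      have y': "(y has_derivative (\<lambda>h. h *\<^sub>R u)) (at t within {0..1})"
        unfolding y_def by (auto intro!: derivative_eq_intros)
      have "((\<lambda>t. f (g (y t))) has_derivative (\<lambda>h. A (g (y t)) (g' (y t) (h *\<^sub>R u)))) (at t within {0..1})"
        by (rule has_derivative_compose[OF has_derivative_compose[OF y' g'[OF yV[OF t]]] f_deriv])
      then show ?thesis
        using linear_cmul[OF has_derivative_linear[OF g'[OF yV[OF t]]]] linear_cmul[OF linear_A] by simp
    qed
    have bound: "norm (A (g (y t)) (g' (y t) u)) \<le> 4 * K * (norm (L (f x') - L (f x)) + W * norm (x' - x))"
      if t: "0 \<le> t" "t \<le> 1" for t
    proof -
      let ?z = "g (y t)" and ?w = "g' (y t) u"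
      have z0: "?z \<in> ball x0 d0" using gU(1)[OF t] U(2) by blast
      \<comment> \<open>The derivative of \<open>g\<close> inverts that of \<open>G\<close>, so the
        path has constant velocity \<open>u\<close> in the chart.\<close>
      have Bw: "B ?z ?w = u"
        using bij[OF yV[OF t]] unfolding g'inv[OF yV[OF t]] BB_apply
        by (simp add: bij_is_surj surj_f_inv_f)
      \<comment> \<open>The two Lipschitz constants 2 of the chart multiply to the 4 in the
        hypothesis on \<open>\<Omega>\<close>: the whole curved path stays within that distance of
        \<open>x\<close>.\<close>
      have "norm (?z - x) \<le> 2 * norm (G ?z - G x)"
        using dist_le_G(1)[OF Bd z0 d0'[OF x(1)]] .
      also have "G ?z - G x = t *\<^sub>R u"
        using gU(2)[OF t] by (simp add: y_def)
      also have "2 * norm (t *\<^sub>R u) \<le> 2 * norm u"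
        using t by (simp add: mult_left_le_one_le)
      finally have "\<Omega> ?z \<le> W"
        using nu by (intro \<Omega>W) simp
      then have \<Omega>u: "\<Omega> ?z * norm u \<le> W * (2 * norm (x' - x))"
        using nu W by (intro mult_mono) auto
      have "norm (A ?z ?w) \<le> 2 * K * (norm (B ?z ?w - P (B ?z ?w)) + \<Omega> ?z * norm (B ?z ?w))"
      proof (rule derivative_estimate)
        show "D ?z \<ge> 1 / 2" using z0 d2(2) by (simp add: d0_def)
      qed (use Bd[OF z0] K[OF z0] in auto)
      also have "\<dots> \<le> 2 * K * (norm (u - P u) + W * (2 * norm (x' - x)))"
        unfolding Bw using K(1)[OF z0] \<Omega>u by (intro mult_left_mono add_left_mono) auto
      also have "\<dots> \<le> 2 * K * (2 * (norm (u - P u) + W * norm (x' - x)))"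
        using K(1)[OF z0] by (intro mult_left_mono) auto
      finally show ?thesis by (simp add: uPu distrib_left mult.assoc)
    qed
    have "norm (f (g (y 1)) - f (g (y 0))) \<le> (4 * K * (norm (L (f x') - L (f x)) + W * norm (x' - x))) * norm (1 - 0 :: real)"
    proof (rule differentiable_bound[of "{0..1}" "\<lambda>t. f (g (y t))" "\<lambda>t h. h *\<^sub>R A (g (y t)) (g' (y t) u)"])
      show "((\<lambda>t. f (g (y t))) has_derivative (\<lambda>h. h *\<^sub>R A (g (y t)) (g' (y t) u))) (at t within {0..1})"
        if "t \<in> {0..1}" for t using that by (intro deriv) auto
      show "onorm (\<lambda>h. h *\<^sub>R A (g (y t)) (g' (y t) u)) \<le> 4 * K * (norm (L (f x') - L (f x)) + W * norm (x' - x))"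
        if "t \<in> {0..1}" for t
      proof (rule onorm_le)
        fix h :: real
        have "norm (A (g (y t)) (g' (y t) u)) \<le> 4 * K * (norm (L (f x') - L (f x)) + W * norm (x' - x))"
          using that by (intro bound) auto
        from mult_left_mono[OF this, of "\<bar>h\<bar>"]
        show "norm (h *\<^sub>R A (g (y t)) (g' (y t) u)) \<le> 4 * K * (norm (L (f x') - L (f x)) + W * norm (x' - x)) * norm h"
          by (simp add: mult.commute)
      qed
    qed auto
    then show ?thesis
      by (simp add: y_def u_def gG)
  qed
  have "4 * K > 0" by (simp add: K_def)
  then show ?thesis
    using d main Bd d0' by blast
qed

end

subsection \<open>Lower bounds for the mass of balls\<close>

text \<open>Points whose image has too little mass around it are covered by one ball preimage per
  colour, each of mass below \<open>(1 / 2 ^ n) powr (e + \<delta>)\<close>. The bound on the number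
  of colours leaves a geometric series for Borel-Cantelli.\<close>

lemma AE_mass_lower_bound_of_coloring:
  fixes f :: "'a::euclidean_space \<Rightarrow> 'b::euclidean_space" and S :: "'a set" and n0 :: nat
  assumes cont: "continuous_on UNIV f" and M: "finite_measure M" and sM: "sets M = sets borel"
    and \<delta>: "\<delta> > 0" and K: "K \<ge> 0"
    and col: "\<And>n. n \<ge> n0 \<Longrightarrow> \<exists>q :: 'a \<Rightarrow> 'c. finite (q ` S) \<and> real (card (q ` S)) \<le> K * (2 ^ n) powr e \<and>
      (\<forall>x\<in>S. \<forall>x'\<in>S. q x = q x' \<longrightarrow> dist (f x) (f x') < 1 / 2 ^ n)"
  shows "AE x in M. x \<in> S \<longrightarrow> (\<forall>\<^sub>F n in sequentially.
    (1 / 2 ^ n) powr (e + \<delta>) \<le> measure M (f -` ball (f x) (1 / 2 ^ n)))"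
proof -
  interpret finite_measure M by fact
  have op: "open (f -` ball y r)" for y r
    using cont by (simp add: open_vimage)
  define E where "E n = {x \<in> S. measure M (f -` ball (f x) (1 / 2 ^ n)) < (1 / 2 ^ n) powr (e + \<delta>)}" for n :: nat
  \<comment> \<open>\<open>E n\<close> may fail to be measurable, so Borel-Cantelli is applied to
    open supersets; below \<open>n0\<close> the empty set is a placeholder.\<close>
  have "\<exists>U. open U \<and> (n \<ge> n0 \<longrightarrow> E n \<subseteq> U) \<and> measure M U \<le> K * (2 powr (- \<delta>)) ^ n" for n
  proof (cases "n \<ge> n0")
    case False
    then show ?thesis using K by (intro exI[of _ "{}"]) auto
  next
    case True
    let ?r = "1 / 2 ^ n :: real"
    obtain q :: "'a \<Rightarrow> 'c" where q: "finite (q ` S)" "real (card (q ` S)) \<le> K * (2 ^ n) powr e"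
      "\<forall>x\<in>S. \<forall>x'\<in>S. q x = q x' \<longrightarrow> dist (f x) (f x') < ?r"
      using col[OF True] by blast
    define F where "F = q ` E n"
    have FS: "F \<subseteq> q ` S" by (auto simp: F_def E_def)
    have finF: "finite F" using FS q(1) finite_subset by blast
    \<comment> \<open>The representative is taken in \<open>E n\<close> itself, so that the ball
      about its image has small mass.\<close>
    define c where "c i = (SOME x. x \<in> E n \<and> q x = i)" for i
    have c: "c i \<in> E n \<and> q (c i) = i" if "i \<in> F" for i
      unfolding c_def by (rule someI_ex) (use that in \<open>auto simp: F_def\<close>)
    define U where "U = (\<Union>i\<in>F. f -` ball (f (c i)) ?r)"
    have "open U" unfolding U_def using op by blast
    moreover have "E n \<subseteq> U"
    proof
      fix x assume x: "x \<in> E n"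
      then have i: "q x \<in> F" by (simp add: F_def)
      have "dist (f (c (q x))) (f x) < ?r"
        using q(3) c[OF i] x by (auto simp: E_def)
      then show "x \<in> U" using i by (auto simp: U_def)
    qed
    moreover have "measure M U \<le> K * (2 powr (- \<delta>)) ^ n"
    proof -
      have "measure M U \<le> (\<Sum>i\<in>F. measure M (f -` ball (f (c i)) ?r))"
        unfolding U_def using finF op sM by (intro finite_measure_subadditive_finite) auto
      also have "\<dots> \<le> (\<Sum>i\<in>F. ?r powr (e + \<delta>))"
        using c by (intro sum_mono) (auto simp: E_def less_imp_le)
      also have "\<dots> \<le> (K * (2 ^ n) powr e) * ?r powr (e + \<delta>)"
        using card_mono[OF q(1) FS] q(2) by (simp add: mult_right_mono)
      also have "\<dots> = K * (2 powr (- \<delta>)) ^ n"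
      proof -
        have "?r = 2 powr (- real n)"
          by (simp add: powr_minus powr_realpow divide_inverse)
        then have "?r powr (e + \<delta>) = 2 powr (- real n * (e + \<delta>))"
          by (simp only: powr_powr)
        moreover have "(2 ^ n) powr e = 2 powr (real n * e)"
          by (simp add: powr_powr flip: powr_realpow)
        ultimately have "(2 ^ n) powr e * ?r powr (e + \<delta>) = 2 powr (real n * e + - real n * (e + \<delta>))"
          by (simp only: powr_add)
        also have "\<dots> = (2 powr (- \<delta>)) powr real n"
          by (simp add: powr_powr algebra_simps)
        also have "\<dots> = (2 powr (- \<delta>)) ^ n"
          by (rule powr_realpow) simp
        finally show ?thesis by simp
      qed
      finally show ?thesis .
    qed
    ultimately show ?thesis by blast
  qed
  then obtain U where U: "\<And>n. open (U n)" "\<And>n. n \<ge> n0 \<Longrightarrow> E n \<subseteq> U n"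
      "\<And>n. measure M (U n) \<le> K * (2 powr (- \<delta>)) ^ n"
    by metis
  have "AE x in M. \<forall>\<^sub>F n in sequentially. x \<in> space M - U n"
  proof (rule borel_cantelli_AE1)
    show "U n \<in> sets M" for n using U(1) sM by simp
    show "emeasure M (U n) < \<infinity>" for n by (simp flip: less_top)
    have "2 powr (- \<delta>) < 1"
      using \<delta> by (simp add: powr_less_one)
    then show "summable (\<lambda>n. measure M (U n))"
      using U(3) by (intro summable_comparison_test'[OF summable_mult[OF summable_geometric]]) auto
  qed
  then show ?thesis
  proof eventually_elim
    case (elim x)
    show ?case
    proof
      assume x: "x \<in> S"
      from elim eventually_ge_at_top[of n0]
      show "\<forall>\<^sub>F n in sequentially. (1 / 2 ^ n) powr (e + \<delta>) \<le> measure M (f -` ball (f x) (1 / 2 ^ n))"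
      proof eventually_elim
        case (elim n)
        then have "x \<notin> E n" using U(2) by blast
        then show ?case using x by (simp add: E_def)
      qed
    qed
  qed
qed

section \<open>Covering the images of flat pieces of the constant rank set\<close>

context straightening_chart_cart
begin

lemma L_f_bounded:
  obtains R where "R \<ge> 0" "\<And>x. x \<in> ball x0 d \<Longrightarrow> norm (L (f x)) \<le> R"
proof -
  have "continuous_on (cball x0 d) (\<lambda>x. L (f x))"
    using linear_continuous_on_compose[OF C_infinity_continuous[OF smooth] linear_L] by (simp add: o_def)
  then have "bounded ((\<lambda>x. L (f x)) ` cball x0 d)"
    by (intro compact_imp_bounded compact_continuous_image) auto
  then obtain R where R: "R > 0" "\<forall>y\<in>(\<lambda>x. L (f x)) ` cball x0 d. norm y \<le> R"
    using bounded_pos by blast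
  show thesis
  proof
    show "R \<ge> 0" using R(1) by simp
    show "norm (L (f x)) \<le> R" if "x \<in> ball x0 d" for x
      using R(2) that by auto
  qed
qed

text \<open>The colour combines \<open>L (f x)\<close> at scale about \<open>r\<close> with
  \<open>x\<close> at the coarser scale about \<open>r powr (1 / m)\<close>. On a colour class
  flatness makes \<open>\<Omega>\<close> of order \<open>r\<close> along the path, so
  \<open>f\<close> varies by less than \<open>r\<close>; the coarse scale costs only the exponent
  \<open>CARD('m) / m\<close>.\<close>

lemma coloring_exists:
  assumes m: "m \<ge> 1" and C: "C > 0" and j: "j \<ge> 0" and \<rho>: "\<rho> > 0"
    and incr: "\<And>x x' W. x \<in> ball x0 d \<Longrightarrow> x' \<in> ball x0 d \<Longrightarrow> W \<ge> 0 \<Longrightarrow>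
      (\<And>z. norm (z - x) \<le> 4 * norm (x' - x) \<Longrightarrow> \<Omega> z \<le> W) \<Longrightarrow>
      norm (f x' - f x) \<le> C * (norm (L (f x') - L (f x)) + W * norm (x' - x))"
    and S: "\<And>x. x \<in> S \<Longrightarrow> x \<in> ball x0 d"
      "\<And>x z. x \<in> S \<Longrightarrow> dist z x < \<rho> \<Longrightarrow> \<Omega> z \<le> j * dist z x ^ m"
  shows "\<exists>n0 K. K \<ge> 0 \<and> (\<forall>n\<ge>n0. \<exists>q :: real ^ 'm \<Rightarrow> (real ^ 'm \<Rightarrow> int) \<times> (real ^ 'm \<Rightarrow> int).
      finite (q ` S) \<and>
      real (card (q ` S)) \<le> K * (2 ^ n) powr (real (differential_rank f x0) + real CARD('m) / real m) \<and>
      (\<forall>x\<in>S. \<forall>x'\<in>S. q x = q x' \<longrightarrow> dist (f x) (f x') < 1 / 2 ^ n))"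
proof -
  obtain R1 where R1: "R1 \<ge> 0" "\<And>x. x \<in> ball x0 d \<Longrightarrow> norm (L (f x)) \<le> R1"
    using L_f_bounded by blast
  define R2 where "R2 = norm x0 + \<bar>d\<bar>"
  have R2: "R2 \<ge> 0" "\<And>x. x \<in> ball x0 d \<Longrightarrow> norm x \<le> R2"
  proof -
    show "norm x \<le> R2" if "x \<in> ball x0 d" for x
      using that norm_triangle_ineq2[of x x0] by (simp add: R2_def dist_norm norm_minus_commute)
  qed (simp add: R2_def)
  obtain K1 where K1: "K1 \<ge> 0" "\<And>s. 0 < s \<Longrightarrow> s \<le> 1 \<Longrightarrow>
    \<exists>q :: real ^ 'm \<Rightarrow> real ^ 'm \<Rightarrow> int. finite (q ` (range L \<inter> cball 0 R1)) \<and>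
      real (card (q ` (range L \<inter> cball 0 R1))) \<le> K1 * (1 / s) ^ dim (range L) \<and>
      (\<forall>u\<in>range L. \<forall>v\<in>range L. q u = q v \<longrightarrow> norm (u - v) \<le> s)"
    using subspace_quantization[OF subspace_range_L R1(1)] by metis
  obtain K2 where K2: "K2 \<ge> 0" "\<And>s. 0 < s \<Longrightarrow> s \<le> 1 \<Longrightarrow>
    \<exists>q :: real ^ 'm \<Rightarrow> real ^ 'm \<Rightarrow> int. finite (q ` (UNIV \<inter> cball 0 R2)) \<and>
      real (card (q ` (UNIV \<inter> cball 0 R2))) \<le> K2 * (1 / s) ^ dim (UNIV :: (real ^ 'm) set) \<and>
      (\<forall>u\<in>UNIV. \<forall>v\<in>UNIV. q u = q v \<longrightarrow> norm (u - v) \<le> s)"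
    using subspace_quantization[OF subspace_UNIV R2(1)] by metis
  \<comment> \<open>\<open>Q\<close> is the total constant of the final estimate in terms of
    \<open>s1\<close>; the factor \<open>c\<close> in \<open>s1\<close> brings \<open>Q * c\<close>
    below 1.\<close>
  define Q where "Q = C * (1 + j * 4 ^ m)"
  define c where "c = 1 / (Q + 1)"
  have Q: "Q > 0" using C j by (simp add: Q_def add_pos_nonneg)
  have c: "c > 0" "c \<le> 1" "Q * c < 1" using Q by (simp_all add: c_def)
  define k where "k = differential_rank f x0"
  define e where "e = real k + real CARD('m) / real m"
  \<comment> \<open>From \<open>n0\<close> on, \<open>4 * s2 < \<rho>\<close> holds below, so the
    flatness bound reaches every \<open>z\<close> that the increment estimate inspects.\<close>
  obtain n0 where n0: "(1 / 2) ^ n0 < (\<rho> / 4) ^ m"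
    using real_arch_pow_inv[of "(\<rho> / 4) ^ m" "1 / 2"] \<rho> by auto
  have main: "\<exists>q :: real ^ 'm \<Rightarrow> (real ^ 'm \<Rightarrow> int) \<times> (real ^ 'm \<Rightarrow> int). finite (q ` S) \<and>
      real (card (q ` S)) \<le> K1 * K2 * (1 / c) powr e * (2 ^ n) powr e \<and>
      (\<forall>x\<in>S. \<forall>x'\<in>S. q x = q x' \<longrightarrow> dist (f x) (f x') < 1 / 2 ^ n)" if n: "n \<ge> n0" for n
  proof -
    define r where "r = (1 / 2 ^ n :: real)"
    have r: "r > 0" "r \<le> 1" by (simp_all add: r_def)
    define s1 where "s1 = c * r"
    have s1: "s1 > 0" "s1 \<le> 1" using c r by (simp_all add: s1_def mult_le_one)
    define s2 where "s2 = s1 powr (1 / real m)"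
    have s2: "s2 > 0" "s2 \<le> 1" using s1 by (simp_all add: s2_def powr_le1)
    have s2m: "s2 ^ m = s1"
      using s1 m by (simp add: s2_def powr_powr flip: powr_realpow)
    have s2\<rho>: "4 * s2 < \<rho>"
    proof -
      have "s2 ^ m \<le> r" using s2m c r by (simp add: s1_def mult_left_le_one_le)
      also have "r \<le> (1 / 2) ^ n0"
        using n by (simp add: r_def power_one_over power_decreasing flip: power_one_over)
      also note n0
      finally have "s2 < \<rho> / 4"
        by (rule power_less_imp_less_base) (use \<rho> in simp)
      then show ?thesis by simp
    qed
    obtain q1 :: "real ^ 'm \<Rightarrow> real ^ 'm \<Rightarrow> int" where q1: "finite (q1 ` (range L \<inter> cball 0 R1))"
      "real (card (q1 ` (range L \<inter> cball 0 R1))) \<le> K1 * (1 / s1) ^ k"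
      "\<And>u v. u \<in> range L \<Longrightarrow> v \<in> range L \<Longrightarrow> q1 u = q1 v \<Longrightarrow> norm (u - v) \<le> s1"
      using K1(2)[OF s1] unfolding dim_range_L k_def by metis
    obtain q2 :: "real ^ 'm \<Rightarrow> real ^ 'm \<Rightarrow> int" where q2: "finite (q2 ` (UNIV \<inter> cball 0 R2))"
      "real (card (q2 ` (UNIV \<inter> cball 0 R2))) \<le> K2 * (1 / s2) ^ CARD('m)"
      "\<And>u v. q2 u = q2 v \<Longrightarrow> norm (u - v) \<le> s2"
      using K2(2)[OF s2] by (auto simp: dim_UNIV)
    define q where "q x = (q1 (L (f x)), q2 x)" for x
    have qS: "q ` S \<subseteq> q1 ` (range L \<inter> cball 0 R1) \<times> q2 ` (UNIV \<inter> cball 0 R2)"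
      using R1(2) R2(2) S(1) by (fastforce simp: q_def)
    have fin: "finite (q1 ` (range L \<inter> cball 0 R1) \<times> q2 ` (UNIV \<inter> cball 0 R2))"
      using q1(1) q2(1) by blast
    have "real (card (q ` S)) \<le> real (card (q1 ` (range L \<inter> cball 0 R1)) * card (q2 ` (UNIV \<inter> cball 0 R2)))"
      using card_mono[OF fin qS] by (simp only: card_cartesian_product of_nat_le_iff)
    also have "\<dots> \<le> (K1 * (1 / s1) ^ k) * (K2 * (1 / s2) ^ CARD('m))"
      unfolding of_nat_mult using q1(2) q2(2) K1(1) s1 by (intro mult_mono) auto
    also have "\<dots> = K1 * K2 * (1 / c) powr e * (2 ^ n) powr e"
    proof -
      have "(1 / s2) ^ CARD('m) = (1 / s1) powr (real CARD('m) / real m)"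
        using s1 s2 by (simp add: s2_def powr_powr powr_divide flip: powr_realpow)
      moreover have "(1 / s1) ^ k = (1 / s1) powr real k"
        using s1 by (simp add: powr_realpow)
      ultimately have "(1 / s1) ^ k * (1 / s2) ^ CARD('m) = (1 / s1) powr e"
        by (simp add: e_def powr_add)
      also have "\<dots> = (1 / c) powr e * (2 ^ n) powr e"
      proof -
        have "1 / s1 = 1 / c * 2 ^ n"
          by (simp add: s1_def r_def)
        then show ?thesis by (simp only: powr_mult)
      qed
      finally have eq: "(1 / s1) ^ k * (1 / s2) ^ CARD('m) = (1 / c) powr e * (2 ^ n) powr e" .
      have "K1 * (1 / s1) ^ k * (K2 * (1 / s2) ^ CARD('m)) = K1 * K2 * ((1 / s1) ^ k * (1 / s2) ^ CARD('m))"
        by (simp only: mult_ac)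
      then show ?thesis unfolding eq by (simp only: mult_ac)
    qed
    finally have card: "real (card (q ` S)) \<le> K1 * K2 * (1 / c) powr e * (2 ^ n) powr e" .
    have "dist (f x) (f x') < 1 / 2 ^ n" if x: "x \<in> S" "x' \<in> S" "q x = q x'" for x x'
    proof -
      have xx': "norm (x' - x) \<le> s2"
        using q2(3)[of x' x] x(3) by (simp add: q_def)
      have LL: "norm (L (f x') - L (f x)) \<le> s1"
        using q1(3)[of "L (f x')" "L (f x)"] x(3) by (simp add: q_def)
      define W where "W = j * (4 ^ m * s1)"
      have W: "W \<ge> 0" using j s1 by (simp add: W_def)
      have \<Omega>W: "\<Omega> z \<le> W" if z: "norm (z - x) \<le> 4 * norm (x' - x)" for z
      proof -
        have zx: "dist z x \<le> 4 * s2" using z xx' by (simp add: dist_norm)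
        then have "\<Omega> z \<le> j * dist z x ^ m"
          using S(2)[OF x(1)] s2\<rho> by simp
        also have "\<dots> \<le> j * (4 * s2) ^ m"
          using j zx by (intro mult_left_mono power_mono) auto
        finally show ?thesis by (simp add: W_def power_mult_distrib s2m)
      qed
      have "norm (f x' - f x) \<le> C * (norm (L (f x') - L (f x)) + W * norm (x' - x))"
        by (rule incr[OF S(1)[OF x(1)] S(1)[OF x(2)] W \<Omega>W])
      also have "\<dots> \<le> C * (s1 + W * 1)"
        using C LL W xx' s2 by (intro mult_left_mono add_mono) auto
      also have "\<dots> = (Q * c) * r"
        by (simp add: W_def Q_def s1_def algebra_simps)
      also have "\<dots> < 1 * r"
        using c(3) r(1) by (intro mult_strict_right_mono)
      finally show ?thesis by (simp add: dist_norm norm_minus_commute r_def)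
    qed
    with card finite_subset[OF qS fin] show ?thesis by blast
  qed
  have "K1 * K2 * (1 / c) powr e \<ge> 0" using K1(1) K2(1) by simp
  with main show ?thesis unfolding e_def k_def by blast
qed

text \<open>The functions \<open>\<omega> (P b)\<close> vanish on the constant rank set, so each is
  flat there almost everywhere. One natural number \<open>j\<close> encodes both constant and
  radius, which leaves countably many pieces.\<close>

lemma AE_flat_near:
  assumes near: "\<And>z w. z \<in> ball x0 d \<Longrightarrow> norm (B z w - w) \<le> norm w / 2"
  shows "AE x in lborel. x \<in> ball x0 d \<and> differential_rank f x = differential_rank f x0 \<longrightarrow>
    (\<exists>j::nat. \<forall>z. dist z x < 1 / real (Suc j) \<longrightarrow> \<Omega> z \<le> real j * dist z x ^ m)"
proof -
  define R where "R = {x. x \<in> ball x0 d \<and> differential_rank f x = differential_rank f x0}"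
  have "AE x in lborel. \<forall>b\<in>Basis. x \<in> R \<longrightarrow>
      (\<exists>C\<ge>0. \<exists>d>0. \<forall>z. dist z x < d \<longrightarrow> norm (\<omega> (P b) z) \<le> C * dist z x ^ m)"
  proof (rule AE_finite_allI)
    fix b
    have "C_k m (\<omega> (P b))" using C_infinity_\<omega> by (simp add: C_infinity_def)
    moreover have "x \<in> R \<longrightarrow> \<omega> (P b) x = 0" for x
      using \<omega>_eq_0[OF near _ P_in_ker] by (simp add: R_def)
    ultimately show "AE x in lborel. x \<in> R \<longrightarrow>
      (\<exists>C\<ge>0. \<exists>d>0. \<forall>z. dist z x < d \<longrightarrow> norm (\<omega> (P b) z) \<le> C * dist z x ^ m)"
      by (intro AE_flat_on_zero_set) auto
  qed simp
  then show ?thesis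
  proof eventually_elim
    case (elim x)
    show ?case
    proof
      assume "x \<in> ball x0 d \<and> differential_rank f x = differential_rank f x0"
      then have "\<forall>b\<in>Basis. \<exists>C d. C \<ge> 0 \<and> d > 0 \<and> (\<forall>z. dist z x < d \<longrightarrow> norm (\<omega> (P b) z) \<le> C * dist z x ^ m)"
        using elim by (auto simp: R_def)
      then obtain C d where Cd: "\<forall>b\<in>Basis. C b \<ge> 0 \<and> d b > 0 \<and> (\<forall>z. dist z x < d b \<longrightarrow> norm (\<omega> (P b) z) \<le> C b * dist z x ^ m)"
        by metis
      define \<delta> where "\<delta> = Min (d ` Basis)"
      have \<delta>: "\<delta> > 0" "\<And>b. b \<in> Basis \<Longrightarrow> \<delta> \<le> d b"
        using Cd by (auto simp: \<delta>_def)
      obtain j :: nat where j: "real j > max (\<Sum>b\<in>Basis. C b) (1 / \<delta>)"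
        using reals_Archimedean2 by blast
      have "\<Omega> z \<le> real j * dist z x ^ m" if z: "dist z x < 1 / real (Suc j)" for z
      proof -
        have "1 / \<delta> < real (Suc j)" using j by simp
        then have "1 / real (Suc j) < \<delta>" using \<delta>(1) by (simp add: field_simps)
        then have z\<delta>: "dist z x < \<delta>" using z by simp
        have "\<Omega> z \<le> (\<Sum>b\<in>Basis. C b * dist z x ^ m)"
          unfolding \<Omega>_def
        proof (rule sum_mono)
          fix b :: "real ^ 'm" assume b: "b \<in> Basis"
          then show "norm (\<omega> (P b) z) \<le> C b * dist z x ^ m"
            using Cd \<delta>(2)[OF b] z\<delta> by force
        qed
        also have "\<dots> = (\<Sum>b\<in>Basis. C b) * dist z x ^ m"
          by (simp add: sum_distrib_right)
        also have "\<dots> \<le> real j * dist z x ^ m"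
          using j by (intro mult_right_mono) auto
        finally show ?thesis .
      qed
      then show "\<exists>j::nat. \<forall>z. dist z x < 1 / real (Suc j) \<longrightarrow> \<Omega> z \<le> real j * dist z x ^ m"
        by blast
    qed
  qed
qed

text \<open>The colouring argument runs on each piece \<open>S j\<close> with \<open>M\<close>
  itself; absolute continuity ensures that the pieces exhaust the constant rank set
  \<open>M\<close>-almost everywhere.\<close>

lemma AE_mass_lower_bound_local:
  assumes M: "finite_measure M" "sets M = sets borel" "absolutely_continuous lborel M"
    and m: "m \<ge> 1" and \<delta>: "\<delta> > 0"
  shows "\<exists>d>0. AE x in M. x \<in> ball x0 d \<longrightarrow> differential_rank f x = differential_rank f x0 \<longrightarrow>
    (\<forall>\<^sub>F n in sequentially. (1 / 2 ^ n) powr (real (differential_rank f x) + real CARD('m) / real m + \<delta>)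
      \<le> measure M (f -` ball (f x) (1 / 2 ^ n)))"
proof -
  obtain d C where d: "d > 0" and C: "C > 0"
    and near: "\<forall>z w. z \<in> ball x0 d \<longrightarrow> norm (B z w - w) \<le> norm w / 2"
    and incr: "\<forall>x x' W. x \<in> ball x0 d \<longrightarrow> x' \<in> ball x0 d \<longrightarrow> W \<ge> 0 \<longrightarrow>
      (\<forall>z. norm (z - x) \<le> 4 * norm (x' - x) \<longrightarrow> \<Omega> z \<le> W) \<longrightarrow>
      norm (f x' - f x) \<le> C * (norm (L (f x') - L (f x)) + W * norm (x' - x))"
    using increment_estimate by auto
  define e where "e = real (differential_rank f x0) + real CARD('m) / real m"
  define S where "S j = {x \<in> ball x0 d. \<forall>z. dist z x < 1 / real (Suc j) \<longrightarrow> \<Omega> z \<le> real j * dist z x ^ m}" for j :: nat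
  have "AE x in M. x \<in> S j \<longrightarrow> (\<forall>\<^sub>F n in sequentially.
      (1 / 2 ^ n) powr (e + \<delta>) \<le> measure M (f -` ball (f x) (1 / 2 ^ n)))" for j
  proof -
    have "\<exists>n0 K. K \<ge> 0 \<and> (\<forall>n\<ge>n0. \<exists>q :: real ^ 'm \<Rightarrow> (real ^ 'm \<Rightarrow> int) \<times> (real ^ 'm \<Rightarrow> int).
      finite (q ` S j) \<and> real (card (q ` S j)) \<le> K * (2 ^ n) powr e \<and>
      (\<forall>x\<in>S j. \<forall>x'\<in>S j. q x = q x' \<longrightarrow> dist (f x) (f x') < 1 / 2 ^ n))"
      unfolding e_def
    proof (rule coloring_exists[OF m C])
      show "0 \<le> real j" "0 < 1 / real (Suc j)" by simp_all
      show "norm (f x' - f x) \<le> C * (norm (L (f x') - L (f x)) + W * norm (x' - x))"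
        if "x \<in> ball x0 d" "x' \<in> ball x0 d" "W \<ge> 0"
          "\<And>z. norm (z - x) \<le> 4 * norm (x' - x) \<Longrightarrow> \<Omega> z \<le> W" for x x' W
        using incr that by blast
      show "x \<in> ball x0 d" if "x \<in> S j" for x using that by (simp add: S_def)
      show "\<Omega> z \<le> real j * dist z x ^ m" if "x \<in> S j" "dist z x < 1 / real (Suc j)" for x z
        using that by (simp add: S_def)
    qed
    then obtain n0 K where K: "K \<ge> 0" and col: "\<forall>n\<ge>n0. \<exists>q :: real ^ 'm \<Rightarrow> (real ^ 'm \<Rightarrow> int) \<times> (real ^ 'm \<Rightarrow> int).
      finite (q ` S j) \<and> real (card (q ` S j)) \<le> K * (2 ^ n) powr e \<and>
      (\<forall>x\<in>S j. \<forall>x'\<in>S j. q x = q x' \<longrightarrow> dist (f x) (f x') < 1 / 2 ^ n)"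
      by auto
    show ?thesis
      by (rule AE_mass_lower_bound_of_coloring[OF C_infinity_continuous[OF smooth] M(1,2) \<delta> K
            col[rule_format]])
  qed
  then have "AE x in M. \<forall>j. x \<in> S j \<longrightarrow> (\<forall>\<^sub>F n in sequentially.
      (1 / 2 ^ n) powr (e + \<delta>) \<le> measure M (f -` ball (f x) (1 / 2 ^ n)))"
    unfolding AE_all_countable by blast
  moreover have "AE x in M. x \<in> ball x0 d \<and> differential_rank f x = differential_rank f x0 \<longrightarrow>
    (\<exists>j::nat. \<forall>z. dist z x < 1 / real (Suc j) \<longrightarrow> \<Omega> z \<le> real j * dist z x ^ m)"
  proof (rule absolutely_continuous_AE[OF _ M(3) AE_flat_near])
    show "sets M = sets lborel" using M(2) by simp
  qed (use near in blast)
  ultimately have "AE x in M. x \<in> ball x0 d \<longrightarrow> differential_rank f x = differential_rank f x0 \<longrightarrow>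
    (\<forall>\<^sub>F n in sequentially. (1 / 2 ^ n) powr (real (differential_rank f x) + real CARD('m) / real m + \<delta>)
      \<le> measure M (f -` ball (f x) (1 / 2 ^ n)))"
  proof eventually_elim
    case (elim x)
    show ?case
    proof (intro impI)
      assume x: "x \<in> ball x0 d" and rank: "differential_rank f x = differential_rank f x0"
      obtain j where "x \<in> S j" using elim(2) x rank by (auto simp: S_def)
      then show "\<forall>\<^sub>F n in sequentially. (1 / 2 ^ n) powr (real (differential_rank f x) + real CARD('m) / real m + \<delta>)
          \<le> measure M (f -` ball (f x) (1 / 2 ^ n))"
        using elim(1)[rule_format, of j] unfolding e_def rank by blast
    qed
  qed
  with d show ?thesis by blast
qed

end

text \<open>Flatness of high enough order \<open>m\<close> pushes the excess exponent
  \<open>CARD('m) / m\<close> down to at most \<open>\<delta> / 2\<close>.\<close>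

lemma AE_mass_lower_bound:
  fixes f :: "real ^ 'm \<Rightarrow> 'b::euclidean_space"
  assumes f: "C_infinity f" and M: "finite_measure M" "sets M = sets borel" "absolutely_continuous lborel M"
    and \<delta>: "\<delta> > 0"
  shows "AE x in M. \<forall>\<^sub>F n in sequentially.
    (1 / 2 ^ n) powr (real (differential_rank f x) + \<delta>) \<le> measure M (f -` ball (f x) (1 / 2 ^ n))"
    (is "AE x in M. ?Q x")
proof -
  obtain m :: nat where m: "real m > real CARD('m) / (\<delta> / 2)"
    using reals_Archimedean2 by blast
  moreover have "real CARD('m) / (\<delta> / 2) > 0"
    using \<delta> by simp
  ultimately have m0: "real m > 0" by linarith
  then have m1: "m \<ge> 1" by simp
  have m\<delta>: "real CARD('m) / real m \<le> \<delta> / 2"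
    using m m0 \<delta> by (simp add: field_simps)
  have local: "\<exists>d>0. AE x in M. x \<in> ball x0 d \<longrightarrow> differential_rank f x = differential_rank f x0 \<longrightarrow> ?Q x" for x0
  proof -
    obtain L where "straightening_chart f x0 L"
      using straightening_chart_exists[OF f] by blast
    then interpret straightening_chart_cart f x0 L
      by (simp add: straightening_chart_cart_def)
    have \<delta>2: "\<delta> / 2 > 0" using \<delta> by simp
    obtain d where d: "d > 0" and ae: "AE x in M. x \<in> ball x0 d \<longrightarrow> differential_rank f x = differential_rank f x0 \<longrightarrow>
      (\<forall>\<^sub>F n in sequentially. (1 / 2 ^ n) powr (real (differential_rank f x) + real CARD('m) / real m + \<delta> / 2)
        \<le> measure M (f -` ball (f x) (1 / 2 ^ n)))"
      using AE_mass_lower_bound_local[OF M m1 \<delta>2] by auto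
    have "AE x in M. x \<in> ball x0 d \<longrightarrow> differential_rank f x = differential_rank f x0 \<longrightarrow> ?Q x"
      using ae
    proof eventually_elim
      case (elim x)
      show ?case
      proof (intro impI)
        assume "x \<in> ball x0 d" "differential_rank f x = differential_rank f x0"
        with elim have "\<forall>\<^sub>F n in sequentially. (1 / 2 ^ n) powr (real (differential_rank f x) + real CARD('m) / real m + \<delta> / 2)
          \<le> measure M (f -` ball (f x) (1 / 2 ^ n))" by blast
        then show "?Q x"
        proof eventually_elim
          case (elim n)
          have "(1 / 2 ^ n) powr (real (differential_rank f x) + \<delta>)
              \<le> (1 / 2 ^ n :: real) powr (real (differential_rank f x) + real CARD('m) / real m + \<delta> / 2)"
          proof (rule powr_mono')
            show "real (differential_rank f x) + real CARD('m) / real m + \<delta> / 2 \<le> real (differential_rank f x) + \<delta>"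
              using m\<delta> by linarith
          qed simp_all
          then show ?case using elim by linarith
        qed
      qed
    qed
    with d show ?thesis by blast
  qed
  have "AE x in M. x \<in> {x. differential_rank f x = k} \<longrightarrow> ?Q x" for k
  proof (rule AE_from_local)
    fix x0 assume "x0 \<in> {x. differential_rank f x = k}"
    then show "\<exists>d>0. AE x in M. x \<in> ball x0 d \<longrightarrow> x \<in> {x. differential_rank f x = k} \<longrightarrow> ?Q x"
      using local[of x0] by simp
  qed
  then have "AE x in M. \<forall>k. x \<in> {x. differential_rank f x = k} \<longrightarrow> ?Q x"
    unfolding AE_all_countable by blast
  then show ?thesis by simp
qed

subsection \<open>Pointwise dimensions from dyadic mass bounds\<close>

text \<open>\<open>n\<close> is the least index whose next dyadic radius falls below
  \<open>r\<close>; minimality yields the upper bound on \<open>r\<close>.\<close>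

lemma eventually_dyadic_at_right_0:
  "\<forall>\<^sub>F r in at_right (0 :: real). \<exists>n\<ge>N. 1 / 2 ^ Suc n < r \<and> r \<le> 1 / 2 ^ n"
proof -
  have "\<exists>n\<ge>N. 1 / 2 ^ Suc n < r \<and> r \<le> 1 / 2 ^ n" if r: "0 < r" "r < 1 / 2 ^ N" for r :: real
  proof -
    have "\<exists>n. 1 / 2 ^ Suc n < r"
    proof -
      obtain n where "(1 / 2) ^ n < r"
        using real_arch_pow_inv[of r "1 / 2"] r by auto
      moreover have "(1 / 2 ^ Suc n :: real) \<le> (1 / 2) ^ n"
        by (simp add: power_one_over divide_left_mono)
      ultimately have "1 / 2 ^ Suc n < r"
        by linarith
      then show ?thesis ..
    qed
    define n where "n = (LEAST n. 1 / 2 ^ Suc n < r)"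
    have n: "1 / 2 ^ Suc n < r"
      unfolding n_def using \<open>\<exists>n. 1 / 2 ^ Suc n < r\<close> by (rule LeastI_ex)
    have "\<not> Suc n \<le> N"
    proof
      assume "Suc n \<le> N"
      then have "(1 :: real) / 2 ^ N \<le> 1 / 2 ^ Suc n"
        by (intro divide_left_mono power_increasing) auto
      then show False using n r by linarith
    qed
    moreover have "r \<le> 1 / 2 ^ n"
    proof (cases n)
      case 0
      have "(1 :: real) / 2 ^ N \<le> 1" by simp
      then have "r \<le> 1" using r(2) by linarith
      then show ?thesis using 0 by simp
    next
      case (Suc n')
      then have "\<not> 1 / 2 ^ Suc n' < r"
        unfolding n_def by (intro not_less_Least) simp
      then show ?thesis by (simp add: Suc)
    qed
    ultimately show ?thesis using n by (intro exI[of _ n]) auto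
  qed
  then show ?thesis
    unfolding eventually_at_right_field by (intro exI[of _ "1 / 2 ^ N"]) auto
qed

text \<open>Multiplicative constants in the mass bounds contribute \<open>c / ln r\<close>, which
  vanishes in the limit.\<close>

lemma tendsto_const_div_ln: "((\<lambda>r. ereal (s + c / ln r)) \<longlongrightarrow> ereal s) (at_right 0)"
proof -
  have "((\<lambda>r. c / ln r) \<longlongrightarrow> 0) (at_right (0 :: real))"
    by (rule tendsto_divide_0[OF tendsto_const filterlim_at_bot_imp_at_infinity[OF ln_at_0]])
  from tendsto_add[OF tendsto_const[of s] this] show ?thesis by simp
qed

lemma Liminf_ext_ln_ratio:
  fixes p :: "real \<Rightarrow> real"
  assumes mono: "\<And>r r'. r \<le> r' \<Longrightarrow> p r \<le> p r'" and pos: "\<And>r. p r \<ge> 0"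
    and bd: "\<forall>\<^sub>F n in sequentially. p (1 / 2 ^ n) \<le> C * (1 / 2 ^ n) powr s"
  shows "ereal s \<le> Liminf (at_right 0) (\<lambda>r. ext_ln (p r) / ereal (ln r))"
proof -
  obtain N where N: "\<And>n. n \<ge> N \<Longrightarrow> p (1 / 2 ^ n) \<le> C * (1 / 2 ^ n) powr s"
    using bd unfolding eventually_sequentially by blast
  \<comment> \<open>\<open>max C 1\<close> keeps the logarithm defined, and
    \<open>2 powr \<bar>s\<bar>\<close> pays for replacing \<open>1 / 2 ^ n\<close> by
    \<open>r\<close>, whatever the sign of \<open>s\<close>.\<close>
  define C' where "C' = max C 1 * 2 powr \<bar>s\<bar>"
  have C': "C' > 0" by (simp add: C'_def)
  \<comment> \<open>Starting at \<open>Suc N\<close> forces \<open>n \<ge> 1\<close>, hence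
    \<open>r < 1\<close> and \<open>ln r < 0\<close>.\<close>
  have "\<forall>\<^sub>F r in at_right 0. ereal (s + ln C' / ln r) \<le> ext_ln (p r) / ereal (ln r)"
    using eventually_dyadic_at_right_0[of "Suc N"]
  proof eventually_elim
    case (elim r)
    then obtain n where n: "n \<ge> Suc N" "1 / 2 ^ Suc n < r" "r \<le> 1 / 2 ^ n" by blast
    have r: "r > 0" using n(2) by (rule less_trans[rotated]) simp
    have "(1 / 2 ^ n :: real) < 1" using n(1) by (simp add: one_less_power)
    then have "r < 1" using n(3) by linarith
    then have lnr: "ln r < 0" using r by simp
    show ?case
    proof (cases "p r = 0")
      case True
      \<comment> \<open>Mass 0 gives minus infinity divided by a negative number, which is plus
        infinity.\<close>
      then show ?thesis
        using lnr by (simp add: ext_ln_def)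
    next
      case False
      have "1 / 2 ^ n = (1 / 2 ^ n / r) * r" using r by simp
      then have "(1 / 2 ^ n) powr s = (1 / 2 ^ n / r) powr s * r powr s"
        by (metis powr_mult)
      also have "(1 / 2 ^ n / r) powr s \<le> 2 powr \<bar>s\<bar>"
      proof -
        have "1 \<le> 1 / 2 ^ n / r" "1 / 2 ^ n / r \<le> 2"
          using n r by (simp_all add: field_simps)
        then have "(1 / 2 ^ n / r) powr s \<le> (1 / 2 ^ n / r) powr \<bar>s\<bar>"
          by (intro powr_mono) auto
        also have "\<dots> \<le> 2 powr \<bar>s\<bar>"
          using \<open>1 / 2 ^ n / r \<le> 2\<close> r by (intro powr_mono2) simp_all
        finally show ?thesis .
      qed
      finally have *: "(1 / 2 ^ n) powr s \<le> 2 powr \<bar>s\<bar> * r powr s"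
        by (simp add: mult_right_mono)
      have "p r \<le> p (1 / 2 ^ n)" by (rule mono) (rule n(3))
      also have "\<dots> \<le> C * (1 / 2 ^ n) powr s" using n(1) by (intro N) simp
      also have "\<dots> \<le> max C 1 * (2 powr \<bar>s\<bar> * r powr s)"
        using * by (intro mult_mono) auto
      finally have "p r \<le> C' * r powr s" by (simp add: C'_def)
      moreover have "p r > 0" using False pos[of r] by simp
      ultimately have "ln (p r) \<le> ln (C' * r powr s)" by simp
      also have "\<dots> = ln C' + s * ln r"
        using C' r by (simp add: ln_mult ln_powr)
      finally have "(ln C' + s * ln r) / ln r \<le> ln (p r) / ln r"
        using lnr by (simp add: divide_right_mono_neg)
      then show ?thesis
        using False lnr by (simp add: ext_ln_def add_divide_distrib add.commute)
    qed
  qed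
  then have "Liminf (at_right 0) (\<lambda>r. ereal (s + ln C' / ln r))
      \<le> Liminf (at_right 0) (\<lambda>r. ext_ln (p r) / ereal (ln r))"
    by (rule Liminf_mono)
  then show ?thesis
    using lim_imp_Liminf[OF trivial_limit_at_right_real tendsto_const_div_ln] by metis
qed

text \<open>The mass bound is used at the next smaller dyadic radius \<open>1 / 2 ^ Suc n\<close>,
  where monotonicity points in the required direction; it also makes \<open>p r\<close>
  positive.\<close>

lemma Limsup_ext_ln_ratio:
  fixes p :: "real \<Rightarrow> real"
  assumes mono: "\<And>r r'. r \<le> r' \<Longrightarrow> p r \<le> p r'"
    and bd: "\<forall>\<^sub>F n in sequentially. (1 / 2 ^ n) powr t \<le> p (1 / 2 ^ n)"
  shows "Limsup (at_right 0) (\<lambda>r. ext_ln (p r) / ereal (ln r)) \<le> ereal t"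
proof -
  obtain N where N: "\<And>n. n \<ge> N \<Longrightarrow> (1 / 2 ^ n) powr t \<le> p (1 / 2 ^ n)"
    using bd unfolding eventually_sequentially by blast
  define c where "c = 2 powr (- \<bar>t\<bar>)"
  have c: "c > 0" by (simp add: c_def)
  have "\<forall>\<^sub>F r in at_right 0. ext_ln (p r) / ereal (ln r) \<le> ereal (t + ln c / ln r)"
    using eventually_dyadic_at_right_0[of "Suc N"]
  proof eventually_elim
    case (elim r)
    then obtain n where n: "n \<ge> Suc N" "1 / 2 ^ Suc n < r" "r \<le> 1 / 2 ^ n" by blast
    have r: "r > 0" using n(2) by (rule less_trans[rotated]) simp
    have "(1 / 2 ^ n :: real) < 1" using n(1) by (simp add: one_less_power)
    then have "r < 1" using n(3) by linarith
    then have lnr: "ln r < 0" using r by simp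
    let ?x = "1 / 2 ^ Suc n / r"
    have half: "1 / 2 * r \<le> 1 / 2 ^ Suc n"
      using n(3) by simp
    have x: "1 / 2 \<le> ?x"
      unfolding pos_le_divide_eq[OF r] by (rule half)
    have x1: "?x \<le> 1"
      unfolding pos_divide_le_eq[OF r] using n(2) by linarith
    have x0: "0 < ?x" using x by linarith
    have "c = (1 / 2) powr \<bar>t\<bar>"
      by (simp add: c_def powr_minus_divide powr_divide)
    also have "\<dots> \<le> ?x powr \<bar>t\<bar>"
      using x by (intro powr_mono2) simp_all
    also have "\<dots> \<le> ?x powr t"
      using x0 x1 by (intro powr_mono') simp_all
    finally have "c * r powr t \<le> ?x powr t * r powr t"
      by (simp add: mult_right_mono)
    also have "\<dots> = (1 / 2 ^ Suc n) powr t"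
      using r by (simp flip: powr_mult)
    also have "\<dots> \<le> p (1 / 2 ^ Suc n)"
      using n(1) by (intro N) simp
    also have "\<dots> \<le> p r"
      using n(2) by (intro mono) simp
    finally have le: "c * r powr t \<le> p r" .
    have "c * r powr t > 0" using c r by simp
    then have pr: "p r > 0" using le by linarith
    have "ln c + t * ln r = ln (c * r powr t)"
      using c r by (simp add: ln_mult ln_powr)
    also have "\<dots> \<le> ln (p r)"
      using le \<open>c * r powr t > 0\<close> by simp
    finally have "ln (p r) / ln r \<le> (ln c + t * ln r) / ln r"
      using lnr by (simp add: divide_right_mono_neg)
    then show ?case
      using pr lnr by (simp add: ext_ln_def add_divide_distrib add.commute)
  qed
  then have "Limsup (at_right 0) (\<lambda>r. ext_ln (p r) / ereal (ln r))
      \<le> Limsup (at_right 0) (\<lambda>r. ereal (t + ln c / ln r))"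
    by (rule Limsup_mono)
  then show ?thesis
    using lim_imp_Limsup[OF trivial_limit_at_right_real tendsto_const_div_ln] by metis
qed

lemma differential_rank_le:
  fixes f :: "'a::euclidean_space \<Rightarrow> 'b::euclidean_space"
  assumes "f differentiable (at x)"
  shows "differential_rank f x \<le> min DIM('a) DIM('b)"
proof -
  have "linear (frechet_derivative f (at x))"
    using assms by (rule linear_frechet_derivative)
  from dim_image_le[OF this, of UNIV] dim_subset_UNIV[of "range (frechet_derivative f (at x))"]
  show ?thesis by (simp add: differential_rank_def)
qed

lemma AE_has_pointwise_dim_along_rank:
  fixes f :: "real ^ 'm \<Rightarrow> 'b::euclidean_space"
  assumes f: "C_infinity f" and M: "finite_measure M" "sets M = sets borel" "absolutely_continuous lborel M"
  shows "AE x in M. has_pointwise_dim_along f M x (ereal (real (differential_rank f x)))"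
proof -
  interpret finite_measure M by fact
  have f_meas: "f \<in> borel_measurable M"
    using borel_measurable_continuous_onI[OF C_infinity_continuous[OF f]]
    by (simp cong: measurable_cong_sets add: M(2))
  define N where "N = distr M borel f"
  have N: "finite_measure N" "sets N = sets borel"
    unfolding N_def by (simp_all add: finite_measure_distr f_meas)
  have spM: "space M = UNIV" using sets_eq_imp_space_eq[OF M(2)] by simp
  have N_ball: "measure N (ball y r) = measure M (f -` ball y r)" for y r
    unfolding N_def by (subst measure_distr[OF f_meas]) (simp_all add: spM)
  \<comment> \<open>The losses run through a sequence tending to 0, so countably many almost sure
    bounds hold together and squeeze both dimensions to the rank.\<close>
  define \<delta> where "\<delta> i = 1 / real (Suc i)" for i
  have \<delta>: "\<delta> i > 0" for i by (simp add: \<delta>_def)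
  have "AE x in M. \<exists>C. \<forall>\<^sub>F n in sequentially.
      measure N (ball (f x) (1 / 2 ^ n)) \<le> C * (1 / 2 ^ n) powr (real (differential_rank f x) - \<delta> i)" for i
    by (rule absolutely_continuous_AE[OF _ M(3) AE_mass_upper_bound[OF f N \<delta>]]) (simp add: M(2))
  then have "AE x in M. \<forall>i. \<exists>C. \<forall>\<^sub>F n in sequentially.
      measure N (ball (f x) (1 / 2 ^ n)) \<le> C * (1 / 2 ^ n) powr (real (differential_rank f x) - \<delta> i)"
    unfolding AE_all_countable by blast
  moreover have "AE x in M. \<forall>i. \<forall>\<^sub>F n in sequentially.
      (1 / 2 ^ n) powr (real (differential_rank f x) + \<delta> i) \<le> measure N (ball (f x) (1 / 2 ^ n))"
    unfolding AE_all_countable N_ball using AE_mass_lower_bound[OF f M \<delta>] by blast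
  ultimately show ?thesis
  proof eventually_elim
    case (elim x)
    let ?k = "real (differential_rank f x)"
    define p where "p r = measure N (ball (f x) r)" for r
    have mono: "p r \<le> p r'" if "r \<le> r'" for r r'
      unfolding p_def using that N by (intro finite_measure.finite_measure_mono) (auto simp: subset_ball)
    let ?inf = "lower_pointwise_dim_along f M x" and ?sup = "upper_pointwise_dim_along f M x"
    have inf_eq: "?inf = Liminf (at_right 0) (\<lambda>r. ext_ln (p r) / ereal (ln r))"
      and sup_eq: "?sup = Limsup (at_right 0) (\<lambda>r. ext_ln (p r) / ereal (ln r))"
      by (simp_all add: lower_pointwise_dim_along_def upper_pointwise_dim_along_def
          lower_pointwise_dim_def upper_pointwise_dim_def p_def N_def)
    have \<delta>0: "\<delta> \<longlonglongrightarrow> 0"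
      using LIMSEQ_Suc[OF lim_1_over_n[where 'a = real]] unfolding \<delta>_def by simp
    have inf_ge: "ereal (?k - \<delta> i) \<le> ?inf" for i
    proof -
      obtain C where "\<forall>\<^sub>F n in sequentially. p (1 / 2 ^ n) \<le> C * (1 / 2 ^ n) powr (?k - \<delta> i)"
        using elim(1) unfolding p_def by blast
      then show ?thesis
        unfolding inf_eq using mono by (intro Liminf_ext_ln_ratio) (auto simp: p_def)
    qed
    have "(\<lambda>i. ereal (?k - \<delta> i)) \<longlonglongrightarrow> ereal ?k"
      using tendsto_diff[OF tendsto_const[of ?k] \<delta>0] by simp
    from LIMSEQ_le_const2[OF this] have lower: "ereal ?k \<le> ?inf"
      using inf_ge by blast
    have sup_le: "?sup \<le> ereal (?k + \<delta> i)" for i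
      unfolding sup_eq using mono elim(2) by (intro Limsup_ext_ln_ratio) (auto simp: p_def)
    have "(\<lambda>i. ereal (?k + \<delta> i)) \<longlonglongrightarrow> ereal ?k"
      using tendsto_add[OF tendsto_const[of ?k] \<delta>0] by simp
    from LIMSEQ_le_const[OF this] have upper: "?sup \<le> ereal ?k"
      using sup_le by blast
    have "?inf \<le> ?sup"
      unfolding inf_eq sup_eq by (rule Liminf_le_Limsup) (rule trivial_limit_at_right_real)
    then have "?inf = ereal ?k" "?sup = ereal ?k"
      using lower upper by (blast intro: order.antisym order.trans)+
    then show ?case
      by (simp add: has_pointwise_dim_along_def)
  qed
qed

theorem theorem9:
  fixes f :: "real ^ 'm \<Rightarrow> real ^ 'n" and \<mu> :: "(real ^ 'm) measure"
  assumes "C_infinity f"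
    and "prob_space \<mu>"
    and "sets \<mu> = sets borel"
    and "absolutely_continuous lborel \<mu>"
  shows "(AE x in \<mu>. \<exists>k\<in>{0..min CARD('m) CARD('n)}.
            has_pointwise_dim_along f \<mu> x (ereal (real k))) \<and>
         (AE x in \<mu>. has_pointwise_dim_along f \<mu> x (ereal (real (differential_rank f x))))"
proof
  interpret prob_space \<mu> by fact
  show ae: "AE x in \<mu>. has_pointwise_dim_along f \<mu> x (ereal (real (differential_rank f x)))"
    by (rule AE_has_pointwise_dim_along_rank[OF assms(1) finite_measure_axioms assms(3,4)])
  have "differential_rank f x \<in> {0..min CARD('m) CARD('n)}" for x
    using differential_rank_le[of f x] C_infinity_has_derivative[OF assms(1)]
    by (auto simp: differentiable_def)
  with ae show "AE x in \<mu>. \<exists>k\<in>{0..min CARD('m) CARD('n)}. has_pointwise_dim_along f \<mu> x (ereal (real k))"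
    by (auto elim!: eventually_mono)
qed

end
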